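(* Let $f$ be a Bernstein function satisfying (A1) and (A2), with Lévy tail $\bar\mu$ and positive Sonine pair $(\bar\mu,k)$, so that $\mathcal L(\bar\mu;\lambda)=f(\lambda)/\lambda$ and $\mathcal L(k;\lambda)=1/f(\lambda)$. Assume that $\limsup_{x\to0}\bar\mu(x)\int_0^xk(s)\,ds<1$, and let $T>0$. Then, for any $\phi_0\in\mathbb R$ and $\lambda\in\mathbb R\setminus\{0\}$, the initial value problem $$D^f_{\mathrm{Ce}}\phi(x)=\lambda\phi(x),\quad x\in(0,T],\qquad \phi(0)=\phi_0,$$ has a unique solution $\phi$ in $C_{\bar\mu}[0,T]$, which is given by $\phi(x)=\phi_0\sum_{i=0}^\infty\big(\lambda I^f_{\mathrm{Ce}}\big)^i\mathbf 1(x)$, where $\mathbf 1$ is the constant function $1$.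
   Context: A Bernstein function with triplet $(a,b,\mu)$ is a function $f(\lambda)=a+b\lambda+\int_{(0,\infty)}(1-e^{-\lambda t})\,\mu(dt)$, $\lambda>0$, with $a,b\ge0$ and $\mu$ a Borel measure on $(0,\infty)$ with $\int\min\{1,t\}\,\mu(dt)<\infty$. Assumptions: (A1) $f$ is a Bernstein function with $f(0+)=0$, $\lim_{x\to\infty}f(x)=\infty$, $\lim_{x\to0}f(x)/x=\infty$, $\lim_{x\to\infty}f(x)/x=0$ (hence the triplet is $(0,0,\mu)$); (A2) $f$ is a complete Bernstein function, i.e. $\mu$ has a completely monotone density with respect to Lebesgue measure. Put $\bar\mu(x)=\mu((x,\infty))$, $x>0$. The conjugate $f^*(x)=x/f(x)$ is again a complete Bernstein function; let $\mu^*$ be its Lévy measure and $k(x)=\mu^*((x,\infty))$, $x>0$. Then $\bar\mu,k$ are completely monotone, locally integrable on $[0,\infty)$, and $(\bar\mu,k)$ is a positive Sonine pair: $\int_0^x\bar\mu(x-t)k(t)\,dt=1$ for all $x>0$; here $\mathcal L(h;\lambda)=\int_0^\infty e^{-\lambda x}h(x)\,dx$. Notation: $(\bar\mu*\phi)(x)=\int_0^x\bar\mu(x-t)\phi(t)\,dt$; $C_{\bar\mu}(0,T]=\{\phi\in C(0,T]\cap L^1(0,T):\bar\mu*\phi\in C^1(0,T]\}$ (one-sided derivative at $T$), $C_{\bar\mu}[0,T]=C[0,T]\cap C_{\bar\mu}(0,T]$. Censored Bernstein derivative of $\phi\in C_{\bar\mu}(0,T]$: $D^f_{\mathrm{Ce}}\phi(x)=\frac{d}{dx}\int_0^x\phi(x-t)\bar\mu(t)\,dt-\phi(x)\bar\mu(x)$,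 $x\in(0,T]$. $I^f_{\mathrm R}\phi(x)=\int_0^x\phi(x-z)k(z)\,dz$ for $x>0$, with value $0$ at $x=0$ for $\phi\in C[0,T]$. $\mathcal K\phi(x)=\int_0^x\bar\mu(r)k(x-r)\phi(r)\,dr$ for $x>0$, $\mathcal K\phi(0)=\phi(0)$; $\mathcal K^0$ is the identity. Censored integral: $I^f_{\mathrm{Ce}}g=\sum_{i=0}^\infty\mathcal K^i[I^f_{\mathrm R}g]$ for $g\in C[0,T]$; it maps $C[0,T]$ into $C[0,T]$, and powers denote iterates (zeroth power = identity). *)

theory Defs
  imports "HOL-Analysis.Analysis"
begin

(* A Borel measure on (0,oo) is encoded as a Borel measure on the real line
   for which {..0} is a null set. *)
definition levy_measure :: "real measure \<Rightarrow> bool" where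
  "levy_measure \<mu> \<longleftrightarrow> sets \<mu> = sets borel \<and> emeasure \<mu> {..0} = 0 \<and>
     (\<integral>\<^sup>+ t. ennreal (min 1 t) \<partial>\<mu>) < \<infinity>"

definition bernstein_triplet ::
  "(real \<Rightarrow> real) \<Rightarrow> real \<Rightarrow> real \<Rightarrow> real measure \<Rightarrow> bool" where
  "bernstein_triplet f a b \<mu> \<longleftrightarrow> 0 \<le> a \<and> 0 \<le> b \<and> levy_measure \<mu> \<and>
     (\<forall>s>0. f s = a + b * s + (LINT t:{0<..}|\<mu>. 1 - exp (- s * t)))"

definition completely_monotone :: "(real \<Rightarrow> real) \<Rightarrow> bool" where
  "completely_monotone g \<longleftrightarrow>
     (\<forall>n. \<forall>x>0. (deriv ^^ n) g field_differentiable (at x) \<and> 0 \<le> (-1) ^ n * (deriv ^^ n) g x)"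

definition complete_bernstein_triplet ::
  "(real \<Rightarrow> real) \<Rightarrow> real \<Rightarrow> real \<Rightarrow> real measure \<Rightarrow> bool" where
  "complete_bernstein_triplet f a b \<mu> \<longleftrightarrow> bernstein_triplet f a b \<mu> \<and>
     (\<exists>m. completely_monotone m \<and>
          \<mu> = density lborel (\<lambda>t. ennreal (indicator {0<..} t * m t)))"

definition conjugate :: "(real \<Rightarrow> real) \<Rightarrow> real \<Rightarrow> real" where
  "conjugate f x = x / f x"

(* Finite for x > 0 when \<mu> is a Levy measure; only used there. *)
definition tail :: "real measure \<Rightarrow> real \<Rightarrow> real" where
  "tail \<mu> x = measure \<mu> {x<..}"

definition conv :: "(real \<Rightarrow> real) \<Rightarrow> (real \<Rightarrow> real) \<Rightarrow> real \<Rightarrow> real" where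
  "conv u v x = (LINT t:{0<..<x}|lborel. u (x - t) * v t)"

(* Functions on [0,T] or (0,T] are total functions whose values elsewhere are
   irrelevant; derivatives are taken within (0,T], hence one-sided at T. *)
definition C1_upto :: "real \<Rightarrow> (real \<Rightarrow> real) set" where
  "C1_upto T = {g. \<exists>g'. continuous_on {0<..T} g' \<and>
     (\<forall>x\<in>{0<..T}. (g has_real_derivative g' x) (at x within {0<..T}))}"

definition C_mubar_open :: "(real \<Rightarrow> real) \<Rightarrow> real \<Rightarrow> (real \<Rightarrow> real) set" where
  "C_mubar_open mubar T = {\<phi>. continuous_on {0<..T} \<phi> \<and> set_integrable lborel {0<..<T} \<phi> \<and>
     conv mubar \<phi> \<in> C1_upto T}"

definition C_mubar_closed :: "(real \<Rightarrow> real) \<Rightarrow> real \<Rightarrow> (real \<Rightarrow> real) set" where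
  "C_mubar_closed mubar T = {\<phi>. continuous_on {0..T} \<phi>} \<inter> C_mubar_open mubar T"

definition D_Ce :: "(real \<Rightarrow> real) \<Rightarrow> real \<Rightarrow> (real \<Rightarrow> real) \<Rightarrow> real \<Rightarrow> real" where
  "D_Ce mubar T \<phi> x =
     vector_derivative (conv \<phi> mubar) (at x within {0<..T}) - \<phi> x * mubar x"

definition I_R :: "(real \<Rightarrow> real) \<Rightarrow> (real \<Rightarrow> real) \<Rightarrow> real \<Rightarrow> real" where
  "I_R k \<phi> x = (if x = 0 then 0 else conv \<phi> k x)"

definition K_op ::
  "(real \<Rightarrow> real) \<Rightarrow> (real \<Rightarrow> real) \<Rightarrow> (real \<Rightarrow> real) \<Rightarrow> real \<Rightarrow> real" where
  "K_op mubar k \<phi> x =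
     (if x = 0 then \<phi> 0 else (LINT r:{0<..<x}|lborel. mubar r * k (x - r) * \<phi> r))"

definition I_Ce ::
  "(real \<Rightarrow> real) \<Rightarrow> (real \<Rightarrow> real) \<Rightarrow> (real \<Rightarrow> real) \<Rightarrow> real \<Rightarrow> real" where
  "I_Ce mubar k g x = (\<Sum>i. (K_op mubar k ^^ i) (I_R k g) x)"

definition censored_ivp_solution ::
  "(real \<Rightarrow> real) \<Rightarrow> real \<Rightarrow> real \<Rightarrow> real \<Rightarrow> (real \<Rightarrow> real) \<Rightarrow> bool" where
  "censored_ivp_solution mubar T lam \<phi>0 \<phi> \<longleftrightarrow> \<phi> \<in> C_mubar_closed mubar T \<and>
     (\<forall>x\<in>{0<..T}. D_Ce mubar T \<phi> x = lam * \<phi> x) \<and> \<phi> 0 = \<phi>0"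

end

theory Submission
  imports Defs
begin

text \<open>Write \<open>K\<close>, \<open>R\<close>, \<open>J\<close> for \<open>K_op\<close>, \<open>I_R\<close>, \<open>I_Ce\<close>. By the Sonine identity, convolving with \<open>k\<close>
  (respectively with \<open>m = mubar\<close>) turns the initial value problem into the integral equation
  \<open>\<phi> = K \<phi> + lam * R \<phi>\<close> and back. The kernel of \<open>K\<close> is a probability density, so \<open>K 1 = 1\<close>, but
  \<open>K\<close> contracts with a factor \<open>\<rho> = sup m(x) \<integral>\<^sub>0\<^sup>x k < 1\<close> with respect to each of the weights
  \<open>w b = R (exp (b * _))\<close>. Hence the Neumann series \<open>J\<close> satisfies
  \<open>\<bar>J g\<bar> \<le> w b / (1 - \<rho>)\<close> whenever \<open>\<bar>g x\<bar> \<le> exp (b * x)\<close>, and since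
  \<open>w b x \<le> exp (b * x) * \<integral>\<^sub>0\<^sup>T exp (- b t) k(t) dt\<close>, the operator \<open>lam * J\<close> is a contraction for the
  weight \<open>exp (b * x)\<close> when \<open>b\<close> is large. The Sonine identity itself comes from
  \<open>\<L>(m) \<L>(k) = 1 / s\<close> by uniqueness of Laplace transforms. Beyond the monotonicity of \<open>m\<close> and
  \<open>k\<close>, complete monotonicity is used only to see that \<open>m\<close> is continuous.\<close>

section \<open>Convolutions on the half-line\<close>

text \<open>The difficulties sit at 0. The integral equation does not see \<open>\<phi> 0\<close>,
  because \<open>K\<close> fixes constants; a bound by a multiple of \<open>w b\<close> forces a
  function to vanish at 0 and so excludes them. For the same reason a solution with value 1 at 0 is
  1 plus a correction \<open>lam * J \<phi>\<close>, and iterating this produces the series of the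
  theorem. In the uniqueness proof the difference \<open>D\<close> of two solutions is only known to
  be continuous with \<open>D 0 = 0\<close>, not to be bounded by a multiple of a weight; so
  \<open>D - lam * J D\<close>, a fixed point of \<open>K\<close>, is first shown to vanish, and
  only then is the contraction \<open>lam * J\<close> used.

  The hypothesis bounds \<open>m x * kint x\<close>, with \<open>kint x\<close> the integral of
  \<open>k\<close> over \<open>(0, x)\<close>, only near 0. Elsewhere
  \<open>m x * kint x < 1\<close> is a strict form of
  \<open>m x * kint x \<le> conv m k x = 1\<close>, and strictness needs \<open>k\<close> to be
  positive and \<open>m\<close> not to be constant on \<open>(0, x)\<close>.

  Since \<open>m\<close> and \<open>k\<close> may be unbounded at 0, derivatives are handled on
  \<open>(0, T]\<close> through integral identities, with the constant of integration fixed by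
  continuity at 0.\<close>

lemma conv_cong:
  assumes "\<And>t. 0 < t \<Longrightarrow> t < x \<Longrightarrow> u t = u' t" "\<And>t. 0 < t \<Longrightarrow> t < x \<Longrightarrow> v t = v' t"
  shows "conv u v x = conv u' v' x"
  unfolding conv_def by (rule set_lebesgue_integral_cong) (auto simp: assms)

lemma set_lborel_reflect:
  fixes g :: "real \<Rightarrow> real"
  shows "set_integrable lborel {0<..<x} (\<lambda>t. g (x - t)) \<longleftrightarrow> set_integrable lborel {0<..<x} g" (is ?I)
    and "(LINT t:{0<..<x}|lborel. g (x - t)) = (LINT t:{0<..<x}|lborel. g t)" (is ?L)
proof -
  have *: "indicator {0<..<x} (x + -1 * t) *\<^sub>R g (x + -1 * t) = indicator {0<..<x} t *\<^sub>R g (x - t)" for t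
    by (auto simp: indicator_def)
  show ?I
    unfolding set_integrable_def
    using lborel_integrable_real_affine_iff[of "-1" "\<lambda>t. indicator {0<..<x} t *\<^sub>R g t" x]
    unfolding * by simp
  show ?L
    unfolding set_lebesgue_integral_def
    using lborel_integral_real_affine[of "-1" "\<lambda>t. indicator {0<..<x} t *\<^sub>R g t" x]
    unfolding * by simp
qed

lemma conv_commute: "conv u v x = conv v u x"
  unfolding conv_def using set_lborel_reflect(2)[of x "\<lambda>t. v (x - t) * u t"]
  by (simp add: mult.commute)

lemma conv_nonneg:
  assumes "\<And>t. 0 < t \<Longrightarrow> t < x \<Longrightarrow> 0 \<le> u t" "\<And>t. 0 < t \<Longrightarrow> t < x \<Longrightarrow> 0 \<le> v t"
  shows "0 \<le> conv u v x"
  unfolding conv_def set_lebesgue_integral_def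
  by (rule integral_nonneg_AE) (auto simp: indicator_def assms)

text \<open>Fubini on the triangle \<open>0 < s < t < x\<close>. As \<open>u\<close> and
  \<open>v\<close> are nonnegative, the integral of \<open>\<bar>P s t\<bar>\<close> over
  \<open>t\<close> is \<open>conv u v (x - s) * \<bar>w s\<bar>\<close>, so the single condition
  \<open>int\<close> yields integrability on the product, and \<open>w\<close> may change sign. The
  condition \<open>uv\<close> is separate because the integral of a non-integrable function is 0 by
  default.\<close>

lemma conv_assoc:
  assumes [measurable]: "u \<in> borel_measurable borel" "v \<in> borel_measurable borel"
    and w: "set_borel_measurable lborel {0<..<x} w"
    and u0: "\<And>t. 0 < t \<Longrightarrow> 0 \<le> u t" and v0: "\<And>t. 0 < t \<Longrightarrow> 0 \<le> v t"
    and uv: "\<And>y. 0 < y \<Longrightarrow> y < x \<Longrightarrow> set_integrable lborel {0<..<y} (\<lambda>t. u (y - t) * v t)"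
    and int: "set_integrable lborel {0<..<x} (\<lambda>s. conv u v (x - s) * w s)"
  shows "conv u (conv v w) x = conv (conv u v) w x"
proof -
  define W where "W = (\<lambda>s. indicator {0<..<x} s * w s)"
  have [measurable]: "W \<in> borel_measurable borel"
    using w by (simp add: W_def set_borel_measurable_def)
  define P where "P = (\<lambda>s t. (if 0 < s \<and> s < t \<and> t < x then u (x - t) * v (t - s) * W s else 0))"
  have [measurable]: "case_prod P \<in> borel_measurable (lborel \<Otimes>\<^sub>M lborel)"
    unfolding P_def by measurable
  have shift: "(\<integral>t. indicator {0<..<x - s} (t - s) *\<^sub>R (u (x - t) * v (t - s)) \<partial>lborel) = conv u v (x - s)" for s
    using lborel_integral_real_affine[of 1 "\<lambda>t. indicator {0<..<x - s} (t - s) *\<^sub>R (u (x - t) * v (t - s))" s]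
    by (simp add: conv_def set_lebesgue_integral_def algebra_simps)
  have shift_int: "integrable lborel (\<lambda>t. indicator {0<..<x - s} (t - s) *\<^sub>R (u (x - t) * v (t - s)))"
    if "0 < s" "s < x" for s
    using lborel_integrable_real_affine_iff[of 1 "\<lambda>t. indicator {0<..<x - s} (t - s) *\<^sub>R (u (x - t) * v (t - s))" s]
      uv[of "x - s"] that
    by (simp add: set_integrable_def algebra_simps)
  have P_eq: "P s t = (if 0 < s \<and> s < x then indicator {0<..<x - s} (t - s) *\<^sub>R (u (x - t) * v (t - s)) * W s else 0)" for s t
    by (auto simp: P_def indicator_def)
  have P_norm: "\<bar>P s t\<bar> = (if 0 < s \<and> s < x then indicator {0<..<x - s} (t - s) *\<^sub>R (u (x - t) * v (t - s)) * \<bar>W s\<bar> else 0)" for s t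
    using u0[of "x - t"] v0[of "t - s"] by (auto simp: P_eq indicator_def abs_mult)
  have in_s: "(\<integral>t. P s t \<partial>lborel) = indicator {0<..<x} s *\<^sub>R (conv u v (x - s) * w s)" for s
    using shift[of s] by (cases "0 < s \<and> s < x") (auto simp: P_eq W_def)
  have "integrable (lborel \<Otimes>\<^sub>M lborel) (case_prod P)"
  proof (rule lborel_pair.Fubini_integrable)
    have "(\<integral>t. norm (P s t) \<partial>lborel) = indicator {0<..<x} s *\<^sub>R \<bar>conv u v (x - s) * w s\<bar>" for s
    proof (cases "0 < s \<and> s < x")
      case True
      then have "(\<integral>t. norm (P s t) \<partial>lborel) = conv u v (x - s) * \<bar>w s\<bar>"
        using shift[of s] by (simp add: P_norm W_def)
      moreover have "0 \<le> conv u v (x - s)"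
        by (rule conv_nonneg) (auto simp: u0 v0)
      ultimately show ?thesis using True by (simp add: abs_mult)
    qed (auto simp: P_eq)
    then show "integrable lborel (\<lambda>s. \<integral>t. norm (case (s, t) of (s, t) \<Rightarrow> P s t) \<partial>lborel)"
      using set_integrable_abs[OF int] by (simp add: set_integrable_def)
    show "AE s in lborel. integrable lborel (\<lambda>t. case (s, t) of (s, t) \<Rightarrow> P s t)"
    proof (intro AE_I2)
      fix s show "integrable lborel (\<lambda>t. case (s, t) of (s, t) \<Rightarrow> P s t)"
        using shift_int[of s] by (cases "0 < s \<and> s < x") (auto simp: P_eq)
    qed
  qed simp
  then have F: "(\<integral>t. \<integral>s. P s t \<partial>lborel \<partial>lborel) = (\<integral>s. \<integral>t. P s t \<partial>lborel \<partial>lborel)"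
    using lborel_pair.Fubini_integral[of P] by simp
  have "(\<integral>s. P s t \<partial>lborel) = indicator {0<..<x} t *\<^sub>R (u (x - t) * conv v w t)" for t
  proof -
    have "P s t = (indicator {0<..<x} t * u (x - t)) * (indicator {0<..<t} s *\<^sub>R (v (t - s) * w s))" for s
      by (auto simp: P_def W_def indicator_def)
    then show ?thesis
      by (simp add: conv_def set_lebesgue_integral_def)
  qed
  with F show ?thesis
    unfolding in_s by (simp add: conv_def[of u] conv_def[of _ w] set_lebesgue_integral_def)
qed

text \<open>Dominated convergence with majorant \<open>B * \<bar>Q t\<bar>\<close>; the moving
  endpoint disturbs the pointwise limit only at \<open>t = x\<close>. The kernel \<open>q\<close>
  may be unbounded, so the continuity is taken from \<open>g\<close>.\<close>

lemma conv_continuous: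
  fixes q g :: "real \<Rightarrow> real"
  assumes q: "set_integrable lborel {0<..<T} q" and g: "continuous_on {0..T} g"
  shows "continuous_on {0..T} (conv g q)"
proof (cases "0 \<le> T")
  case True
  \<comment> \<open>Clamping the argument gives a bounded continuous function on the whole line, so
    \<open>G (X n - t)\<close> converges even for \<open>t\<close> beyond \<open>X n\<close>, where
    the indicator makes its value irrelevant.\<close>
  define G where "G = (\<lambda>x. g (max 0 (min T x)))"
  have G: "continuous_on UNIV G"
    unfolding G_def using True
    by (intro continuous_on_compose2[OF g] continuous_intros) auto
  then have [measurable]: "G \<in> borel_measurable borel" 
    by (rule borel_measurable_continuous_onI)
  define Q where "Q = (\<lambda>t. indicator {0<..<T} t * q t)"
  have Qi: "integrable lborel Q" using q by (simp add: Q_def set_integrable_def)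
  then have [measurable]: "Q \<in> borel_measurable borel" by auto
  obtain B where B: "\<And>x. x \<in> {0..T} \<Longrightarrow> \<bar>g x\<bar> \<le> B"
    using compact_continuous_image[OF g] compact_imp_bounded by (fastforce simp: bounded_iff)
  then have GB: "\<bar>G x\<bar> \<le> B" for x using True by (auto simp: G_def)
  have eq: "conv g q x = (\<integral>t. indicator {0<..<x} t * (G (x - t) * Q t) \<partial>lborel)" if "x \<in> {0..T}" for x
    unfolding conv_def set_lebesgue_integral_def
    by (rule Bochner_Integration.integral_cong) (use that in \<open>auto simp: indicator_def G_def Q_def\<close>)
  have "continuous_on {0..T} (\<lambda>x. \<integral>t. indicator {0<..<x} t * (G (x - t) * Q t) \<partial>lborel)"
    unfolding continuous_on_sequentially comp_def
  proof (intro allI ballI impI, elim conjE)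
    fix X :: "nat \<Rightarrow> real" and x assume X: "X \<longlonglongrightarrow> x"
    show "(\<lambda>n. \<integral>t. indicator {0<..<X n} t * (G (X n - t) * Q t) \<partial>lborel) \<longlonglongrightarrow>
      (\<integral>t. indicator {0<..<x} t * (G (x - t) * Q t) \<partial>lborel)"
    proof (rule integral_dominated_convergence[where w="\<lambda>t. B * \<bar>Q t\<bar>"])
      show "integrable lborel (\<lambda>t. B * \<bar>Q t\<bar>)" using Qi by auto
      have "AE t in lborel. t \<noteq> x" by (rule AE_lborel_singleton)
      then show "AE t in lborel. (\<lambda>n. indicator {0<..<X n} t * (G (X n - t) * Q t))
          \<longlonglongrightarrow> indicator {0<..<x} t * (G (x - t) * Q t)"
      proof eventually_elim
        fix t assume "t \<noteq> x"
        have "\<forall>\<^sub>F n in sequentially. indicator {0<..<X n} t = (indicator {0<..<x} t :: real)"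
        proof (cases "t < x")
          case True
          then have "\<forall>\<^sub>F n in sequentially. t < X n" using X by (simp add: order_tendstoD)
          then show ?thesis by eventually_elim (use True in \<open>auto simp: indicator_def\<close>)
        next
          case False
          then have "\<forall>\<^sub>F n in sequentially. X n < t" using X \<open>t \<noteq> x\<close> by (simp add: order_tendstoD)
          then show ?thesis by eventually_elim (use False in \<open>auto simp: indicator_def\<close>)
        qed
        then have 1: "(\<lambda>n. indicator {0<..<X n} t :: real) \<longlonglongrightarrow> indicator {0<..<x} t"
          by (rule tendsto_eventually)
        have "isCont G (x - t)" using G by (simp add: continuous_on_eq_continuous_at)
        then have 2: "(\<lambda>n. G (X n - t)) \<longlonglongrightarrow> G (x - t)"
          by (rule isCont_tendsto_compose) (intro tendsto_intros X)
        show "(\<lambda>n. indicator {0<..<X n} t * (G (X n - t) * Q t)) \<longlonglongrightarrow> indicator {0<..<x} t * (G (x - t) * Q t)"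
          by (intro tendsto_intros 1 2)
      qed
      show "AE t in lborel. norm (indicator {0<..<X n} t * (G (X n - t) * Q t)) \<le> B * \<bar>Q t\<bar>" for n
        using mult_right_mono[OF GB, of "\<bar>Q t\<bar>" for t] mult_nonneg_nonneg[OF order_trans[OF abs_ge_zero GB] abs_ge_zero]
        by (intro AE_I2) (auto simp: indicator_def abs_mult)
    qed (auto simp: measurable_completion)
  qed
  then show ?thesis
    by (subst continuous_on_cong[OF refl eq]) auto
qed simp

lemma conv_at_0 [simp]: "conv u v 0 = 0"
  by (simp add: conv_def set_lebesgue_integral_def)

lemma continuous_on_IocI:
  fixes f :: "real \<Rightarrow> 'a::topological_space"
  assumes "\<And>a. 0 < a \<Longrightarrow> continuous_on {a..T} f"
  shows "continuous_on {0<..T} f"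
  unfolding continuous_on_eq_continuous_within
proof
  fix x assume x: "x \<in> {0<..T}"
  then have "continuous (at x within {x/2..T}) f"
    using assms[of "x/2"] by (auto simp: continuous_on_eq_continuous_within)
  moreover have "at x within {x/2..T} = at x within {0<..T}"
    using x by (intro at_within_nhd[where S="{x/2<..}"]) auto
  ultimately show "continuous (at x within {0<..T}) f" by simp
qed

text \<open>After the substitution \<open>r = x s\<close> the integrand is, for \<open>a \<le> x \<le> T\<close>, dominated by its
  value at \<open>x = a\<close>, and it converges away from the countably many jumps of \<open>q\<close>.\<close>
lemma antimono_kernel:
  fixes p q \<phi> :: "real \<Rightarrow> real"
  assumes [measurable]: "p \<in> borel_measurable borel" "q \<in> borel_measurable borel"
    and p0: "\<And>t. 0 < t \<Longrightarrow> 0 \<le> p t" and q0: "\<And>t. 0 < t \<Longrightarrow> 0 \<le> q t"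
    and p_anti: "\<And>s t. 0 < s \<Longrightarrow> s \<le> t \<Longrightarrow> p t \<le> p s"
    and q_anti: "\<And>s t. 0 < s \<Longrightarrow> s \<le> t \<Longrightarrow> q t \<le> q s"
    and p_int: "\<And>x. 0 < x \<Longrightarrow> set_integrable lborel {0<..<x} p"
    and q_int: "\<And>x. 0 < x \<Longrightarrow> set_integrable lborel {0<..<x} q"
  shows antimono_kernel_integrable:
      "0 < x \<Longrightarrow> set_integrable lborel {0<..<x} (\<lambda>r. p r * q (x - r))"
    and antimono_kernel_continuous:
      "continuous_on {0<..} p \<Longrightarrow> continuous_on {0<..T} \<phi> \<Longrightarrow> (\<And>x. 0 < x \<Longrightarrow> x \<le> T \<Longrightarrow> \<bar>\<phi> x\<bar> \<le> B) \<Longrightarrow>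
       continuous_on {0<..T} (\<lambda>x. LINT r:{0<..<x}|lborel. p r * q (x - r) * \<phi> r)"
proof -
  have scaled: "set_integrable lborel {0<..<1} (\<lambda>s. g (a * s))"
    if "0 < a" "set_integrable lborel {0<..<a} g" for g :: "real \<Rightarrow> real" and a :: real
  proof -
    have "indicator {0<..<a} (0 + a * s) = (indicator {0<..<1} s :: real)" for s
      using \<open>0 < a\<close> by (auto simp: indicator_def zero_less_mult_iff)
    then show ?thesis
      using lborel_integrable_real_affine_iff[of a "\<lambda>t. indicator {0<..<a} t *\<^sub>R g t" 0] that
      by (simp add: set_integrable_def)
  qed
  \<comment> \<open>The factors are never near their singularities together: for
    \<open>s \<le> 1/2\<close> the factor \<open>q\<close> is at most \<open>q (a/2)\<close>,
    otherwise \<open>p\<close> is at most \<open>p (a/2)\<close>, so the product is below a sum of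
    two integrable functions.\<close>
  have dom: "set_integrable lborel {0<..<1} (\<lambda>s. p (a * s) * q (a * (1 - s)))" if a: "0 < a" for a
  proof (rule set_integrable_bound)
    have "set_integrable lborel {0<..<1} (\<lambda>s. q (a * (1 - s)))"
      using set_lborel_reflect(1)[of 1 "\<lambda>s. q (a * s)"] scaled[OF a q_int[OF a]] by simp
    then show "set_integrable lborel {0<..<1} (\<lambda>s. q (a/2) * p (a * s) + p (a/2) * q (a * (1 - s)))"
      using scaled[OF a p_int[OF a]] by (intro set_integral_add set_integrable_mult_right) auto
    show "AE s in lborel. s \<in> {0<..<1} \<longrightarrow> norm (p (a * s) * q (a * (1 - s)))
        \<le> norm (q (a/2) * p (a * s) + p (a/2) * q (a * (1 - s)))"
    proof (intro AE_I2 impI)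
      fix s :: real assume s: "s \<in> {0<..<1}"
      have nn: "0 \<le> p (a * s)" "0 \<le> q (a * (1 - s))" "0 \<le> p (a/2)" "0 \<le> q (a/2)"
        using s a by (auto intro!: p0 q0 mult_pos_pos)
      have "p (a * s) * q (a * (1 - s)) \<le> q (a/2) * p (a * s) + p (a/2) * q (a * (1 - s))"
      proof (cases "s \<le> 1/2")
        case True
        then have "q (a * (1 - s)) \<le> q (a/2)" using a by (intro q_anti) auto
        then have "p (a * s) * q (a * (1 - s)) \<le> p (a * s) * q (a/2)" 
          using nn by (intro mult_left_mono)
        then show ?thesis using mult_nonneg_nonneg[OF nn(3,2)] by (simp add: mult.commute[of "q (a/2)"])
      next
        case False
        then have "p (a * s) \<le> p (a/2)" using a by (intro p_anti) auto
        then have "p (a * s) * q (a * (1 - s)) \<le> p (a/2) * q (a * (1 - s))" 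
          using nn by (intro mult_right_mono)
        then show ?thesis using mult_nonneg_nonneg[OF nn(4,1)] by simp
      qed
      then show "norm (p (a * s) * q (a * (1 - s))) \<le> norm (q (a/2) * p (a * s) + p (a/2) * q (a * (1 - s)))"
        using nn by simp
    qed
  qed (auto simp: set_borel_measurable_def)
  have ind: "indicator {0<..<x} (0 + x * s) = (indicator {0<..<1} s :: real)" if "0 < x" for s x :: real
    using that by (auto simp: indicator_def zero_less_mult_iff)
  show "set_integrable lborel {0<..<x} (\<lambda>r. p r * q (x - r))" if "0 < x"
    using lborel_integrable_real_affine_iff[of x "\<lambda>r. indicator {0<..<x} r *\<^sub>R (p r * q (x - r))" 0] 
      dom[OF that] that ind[OF that]
    by (simp add: set_integrable_def right_diff_distrib)
  assume p_cont: "continuous_on {0<..} p" and \<phi>: "continuous_on {0<..T} \<phi>"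
    and B: "\<And>x. 0 < x \<Longrightarrow> x \<le> T \<Longrightarrow> \<bar>\<phi> x\<bar> \<le> B"
  show "continuous_on {0<..T} (\<lambda>x. LINT r:{0<..<x}|lborel. p r * q (x - r) * \<phi> r)"
  proof (rule continuous_on_IocI)
    fix a :: real assume a: "0 < a"
    have [measurable]: "(\<lambda>s. indicator {0<..T} s * \<phi> s) \<in> borel_measurable borel"
      using set_measurable_continuous_on[OF _ \<phi>] by (simp add: set_borel_measurable_def)
    define F where "F = (\<lambda>x s. indicator {0<..<1} s * (x * (p (x * s) * q (x * (1 - s)) * (indicator {0<..T} (x * s) * \<phi> (x * s)))))"
    have [measurable]: "F x \<in> borel_measurable lborel" for x
    proof -
      have [measurable]: "(\<lambda>s. indicator {0<..T} (x * s) * \<phi> (x * s)) \<in> borel_measurable borel"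
        by (rule measurable_compose[where g="\<lambda>s. indicator {0<..T} s * \<phi> s"]) measurable
      show ?thesis unfolding F_def by measurable
    qed
    have eq: "(LINT r:{0<..<x}|lborel. p r * q (x - r) * \<phi> r) = (\<integral>s. F x s \<partial>lborel)" if x: "x \<in> {a..T}" for x
    proof -
      have "x > 0" using x a by auto
      have "(LINT r:{0<..<x}|lborel. p r * q (x - r) * \<phi> r) = 
         x * (\<integral>s. indicator {0<..<x} (0 + x * s) *\<^sub>R (p (x * s) * q (x - x * s) * \<phi> (x * s)) \<partial>lborel)"
        using lborel_integral_real_affine[of x "\<lambda>r. indicator {0<..<x} r *\<^sub>R (p r * q (x - r) * \<phi> r)" 0] \<open>x > 0\<close>
        by (simp add: set_lebesgue_integral_def)
      also have "\<dots> = (\<integral>s. x * (indicator {0<..<1} s *\<^sub>R (p (x * s) * q (x - x * s) * \<phi> (x * s))) \<partial>lborel)"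
        by (subst ind[OF \<open>x > 0\<close>]) simp
      also have "\<dots> = (\<integral>s. F x s \<partial>lborel)"
      proof (rule Bochner_Integration.integral_cong)
        fix s
        have "0 < x * s \<and> x * s \<le> T" if "0 < s" "s < 1" 
          using that x \<open>x > 0\<close> order_trans[OF mult_left_le[of s x], of T] by auto
        then show "x * (indicator {0<..<1} s *\<^sub>R (p (x * s) * q (x - x * s) * \<phi> (x * s))) = F x s"
          by (auto simp: F_def indicator_def right_diff_distrib)
      qed simp
      finally show ?thesis .
    qed
    have "continuous_on {a..T} (\<lambda>x. \<integral>s. F x s \<partial>lborel)"
      unfolding continuous_on_sequentially comp_def
    proof (intro allI ballI impI, elim conjE)
      fix X :: "nat \<Rightarrow> real" and x assume x: "x \<in> {a..T}" and Xi: "\<forall>n. X n \<in> {a..T}" and X: "X \<longlonglongrightarrow> x"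
      then have x0: "0 < x" and X0: "\<And>n. 0 < X n" using a by (auto intro: less_le_trans)
      have B0: "0 \<le> B" using B[of x] x x0 by auto
      \<comment> \<open>The increasing function \<open>- q\<close> has countably many
        discontinuities, and \<open>t \<mapsto> 1 - t/x\<close> carries them to the values of
        \<open>s\<close> for which \<open>x * (1 - s)\<close> is one of them.\<close>
      define N where "N = {t\<in>{0<..}. \<not> isCont (\<lambda>t. - q t) t}"
      have "countable N" unfolding N_def
        by (rule mono_on_ctble_discont_open) (auto simp: mono_on_def q_anti)
      then have N: "countable ((\<lambda>t. 1 - t/x) ` N)" by simp
      show "(\<lambda>n. \<integral>s. F (X n) s \<partial>lborel) \<longlonglongrightarrow> (\<integral>s. F x s \<partial>lborel)"
      proof (rule integral_dominated_convergence[where w="\<lambda>s. (T * B) * (indicator {0<..<1} s *\<^sub>R (p (a * s) * q (a * (1 - s))))"])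
        show "integrable lborel (\<lambda>s. (T * B) * (indicator {0<..<1} s *\<^sub>R (p (a * s) * q (a * (1 - s)))))"
          using dom[OF a] unfolding set_integrable_def by (rule integrable_mult_right)
        have "AE s in lborel. s \<notin> (\<lambda>t. 1 - t/x) ` N"
          by (rule AE_not_in, rule null_setsI)
            (use N in \<open>auto simp: emeasure_lborel_countable sets.countable[OF _ N]\<close>)
        then show "AE s in lborel. (\<lambda>n. F (X n) s) \<longlonglongrightarrow> F x s"
        proof eventually_elim
          fix s assume s: "s \<notin> (\<lambda>t. 1 - t/x) ` N"
          show "(\<lambda>n. F (X n) s) \<longlonglongrightarrow> F x s"
          proof (cases "0 < s \<and> s < 1")
            case True
            have "x * (1 - s) \<notin> N"
              using s x0 by (auto simp: image_iff dest!: bspec[of _ _ "x * (1 - s)"])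
            then have "isCont (\<lambda>t. - q t) (x * (1 - s))" using True x0 by (auto simp: N_def)
            then have qc: "isCont q (x * (1 - s))"
              using continuous_minus[of "at (x * (1 - s))" "\<lambda>t. - q t"] by simp
            have q_lim: "(\<lambda>n. q (X n * (1 - s))) \<longlonglongrightarrow> q (x * (1 - s))"
              by (rule isCont_tendsto_compose[OF qc]) (intro tendsto_intros X)
            have "isCont p (x * s)" using p_cont True x0 by (auto simp: continuous_on_eq_continuous_at)
            then have p_lim: "(\<lambda>n. p (X n * s)) \<longlonglongrightarrow> p (x * s)"
              by (rule isCont_tendsto_compose) (intro tendsto_intros X)
            have in_T: "0 < y * s \<and> y * s \<le> T" if "y \<in> {a..T}" for y
              using that a True order_trans[OF mult_left_le[of s y], of T] less_le_trans[of 0 a y] by auto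
            have \<phi>_lim: "(\<lambda>n. \<phi> (X n * s)) \<longlonglongrightarrow> \<phi> (x * s)"
              by (rule continuous_on_tendsto_compose[OF \<phi>]) (use in_T x Xi in \<open>auto intro!: tendsto_intros X\<close>)
            have F_eq: "F y s = y * (p (y * s) * q (y * (1 - s)) * \<phi> (y * s))" if "y \<in> {a..T}" for y
              using in_T[OF that] True by (simp add: F_def)
            show ?thesis using x Xi 
              by (simp only: F_eq) (intro tendsto_intros X q_lim p_lim \<phi>_lim)
          qed (auto simp: F_def)
        qed
        show "AE s in lborel. norm (F (X n) s) \<le> (T * B) * (indicator {0<..<1} s *\<^sub>R (p (a * s) * q (a * (1 - s))))" for n
        proof (intro AE_I2)
          fix s
          show "norm (F (X n) s) \<le> (T * B) * (indicator {0<..<1} s *\<^sub>R (p (a * s) * q (a * (1 - s))))"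
          proof (cases "0 < s \<and> s < 1")
            case True
            have Xn: "a \<le> X n" "X n \<le> T" using Xi by auto
            have in_T: "0 < X n * s \<and> X n * s \<le> T"
              using Xn X0[of n] True order_trans[OF mult_left_le[of s "X n"], of T] by auto
            have pp: "p (X n * s) \<le> p (a * s)" using Xn True a by (intro p_anti) auto
            have qq: "q (X n * (1 - s)) \<le> q (a * (1 - s))" using Xn True a by (intro q_anti) auto
            have nn: "0 \<le> p (X n * s)" "0 \<le> q (X n * (1 - s))" "0 \<le> q (a * (1 - s))" "0 \<le> p (a * s)" 
              using X0[of n] True a by (auto intro!: p0 q0 mult_pos_pos)
            have "norm (F (X n) s) = X n * (p (X n * s) * q (X n * (1 - s)) * \<bar>\<phi> (X n * s)\<bar>)"
              using in_T True nn X0[of n] by (simp add: F_def abs_mult)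
            also have "\<dots> \<le> T * (p (a * s) * q (a * (1 - s)) * B)"
              using in_T Xn nn pp qq B B0 X0[of n] by (intro mult_mono mult_nonneg_nonneg) auto
            finally show ?thesis using True by (simp add: mult_ac)
          qed (auto simp: F_def)
        qed
      qed auto
    qed
    then show "continuous_on {a..T} (\<lambda>x. LINT r:{0<..<x}|lborel. p r * q (x - r) * \<phi> r)"
      by (subst continuous_on_cong[OF refl eq]) auto
  qed
qed

section \<open>Neumann series in weighted norms\<close>

text \<open>Used twice: for \<open>K\<close> with weight \<open>w b\<close>, and for
  \<open>lam * J\<close> with weight \<open>exp (b * x)\<close>. The estimates have the form
  \<open>\<bar>\<phi> x\<bar> \<le> c * w x\<close> instead of a norm of a quotient because
  \<open>w b\<close> vanishes at 0. The constant \<open>W\<close> is there for uniform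
  convergence.\<close>

locale weighted_contraction =
  fixes X :: "'a::topological_space set" and A :: "('a \<Rightarrow> real) \<Rightarrow> 'a \<Rightarrow> real"
    and w h :: "'a \<Rightarrow> real" and q c W :: real
  assumes cont: "\<And>\<phi>. continuous_on X \<phi> \<Longrightarrow> continuous_on X (A \<phi>)"
    and add: "\<And>\<phi> \<psi> x. continuous_on X \<phi> \<Longrightarrow> continuous_on X \<psi> \<Longrightarrow> x \<in> X \<Longrightarrow>
      A (\<lambda>x. \<phi> x + \<psi> x) x = A \<phi> x + A \<psi> x"
    and bound: "\<And>\<phi> c x. continuous_on X \<phi> \<Longrightarrow> 0 \<le> c \<Longrightarrow> (\<And>x. x \<in> X \<Longrightarrow> \<bar>\<phi> x\<bar> \<le> c * w x) \<Longrightarrow>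
      x \<in> X \<Longrightarrow> \<bar>A \<phi> x\<bar> \<le> q * c * w x"
    and q: "0 \<le> q" "q < 1" and c: "0 \<le> c"
    and w: "\<And>x. x \<in> X \<Longrightarrow> 0 \<le> w x" "\<And>x. x \<in> X \<Longrightarrow> w x \<le> W"
    and h: "continuous_on X h" "\<And>x. x \<in> X \<Longrightarrow> \<bar>h x\<bar> \<le> c * w x"
begin

definition S :: "'a \<Rightarrow> real" where
  "S x = (\<Sum>i. (A ^^ i) h x)"

text \<open>\<open>A\<close> is additive, hence passes through partial sums only. The fixed-point
  equation survives the limit because \<open>bound\<close>, applied to the remainder
  \<open>S - s n\<close>, makes \<open>A (S - s n)\<close> decay geometrically.\<close>

lemma neumann_series:
  shows neumann_series_summable: "x \<in> X \<Longrightarrow> summable (\<lambda>i. (A ^^ i) h x)"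
    and neumann_series_continuous: "continuous_on X S"
    and neumann_series_fixed_point: "x \<in> X \<Longrightarrow> S x = h x + A S x"
    and neumann_series_bound: "x \<in> X \<Longrightarrow> \<bar>S x\<bar> \<le> c / (1 - q) * w x"
proof -
  define a where "a = (\<lambda>i. (A ^^ i) h)"
  have a_cont: "continuous_on X (a i)" for i
    by (induction i) (auto simp: a_def h cont)
  have a_bound: "\<bar>a i x\<bar> \<le> (q ^ i * c) * w x" if "x \<in> X" for i x
    using that
  proof (induction i arbitrary: x)
    case (Suc i)
    have "\<bar>A (a i) x\<bar> \<le> q * (q ^ i * c) * w x"
      using Suc q c by (intro bound a_cont) auto
    then show ?case by (simp add: a_def mult_ac)
  qed (use h in \<open>auto simp: a_def\<close>)
  have geo: "summable (\<lambda>i. q ^ i * c * y)" for y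
    using q by (intro summable_mult2 summable_geometric) auto
  have sm: "summable (\<lambda>i. a i x)" if "x \<in> X" for x
    by (rule summable_comparison_test'[OF geo[of "w x"]]) (use a_bound[OF that] in auto)
  have S: "S = (\<lambda>x. \<Sum>i. a i x)" by (simp add: S_def[abs_def] a_def)
  have "uniform_limit X (\<lambda>n x. \<Sum>i<n. a i x) S sequentially"
    unfolding S
  proof (rule Weierstrass_m_test[OF _ geo[of W]])
    fix n x assume "x \<in> X"
    then have "q ^ n * c * w x \<le> q ^ n * c * W" using w q c by (intro mult_left_mono) auto
    then show "norm (a n x) \<le> q ^ n * c * W" using a_bound[OF \<open>x \<in> X\<close>, of n] by simp
  qed
  then show S_cont: "continuous_on X S"
    by (rule uniform_limit_theorem[rotated])
      (auto intro!: always_eventually continuous_on_sum a_cont)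
  define s where "s = (\<lambda>n x. \<Sum>i<n. a i x)"
  have s_cont: "continuous_on X (s n)" for n
    unfolding s_def by (intro continuous_intros a_cont)
  have remainder: "\<bar>S x - s n x\<bar> \<le> (q ^ n * c / (1 - q)) * w x" if x: "x \<in> X" for n x
  proof -
    have sm_abs: "summable (\<lambda>i. \<bar>a (i + n) x\<bar>)"
      by (rule summable_comparison_test'[OF summable_ignore_initial_segment[OF geo[of "w x"], of n]])
        (use a_bound[OF x] in auto)
    have "S x - s n x = (\<Sum>i. a (i + n) x)"
      using suminf_minus_initial_segment[OF sm[OF x]] by (simp add: S s_def)
    also have "\<bar>\<dots>\<bar> \<le> (\<Sum>i. \<bar>a (i + n) x\<bar>)"
      by (rule summable_rabs) (rule sm_abs)
    also have "\<dots> \<le> (\<Sum>i. q ^ (i + n) * c * w x)"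
      by (rule suminf_le[OF a_bound[OF x] sm_abs summable_ignore_initial_segment[OF geo]])
    also have "\<dots> = (\<Sum>i. q ^ i * (q ^ n * c * w x))"
      by (simp add: power_add mult_ac)
    also have "\<dots> = (1 / (1 - q)) * (q ^ n * c * w x)"
      using suminf_mult2[of "\<lambda>i. q ^ i" "q ^ n * c * w x"] suminf_geometric[of q] summable_geometric[of q] q by simp
    finally show ?thesis by simp
  qed
  show "summable (\<lambda>i. (A ^^ i) h x)" if "x \<in> X" using sm[OF that] by (simp add: a_def)
  show "\<bar>S x\<bar> \<le> c / (1 - q) * w x" if "x \<in> X" using remainder[OF that, of 0] by (simp add: s_def)
  have A_s: "A (s n) x = s (Suc n) x - h x" if x: "x \<in> X" for n x
  proof (induction n)
    case 0
    \<comment> \<open>The empty partial sum is the zero function, and \<open>bound\<close> with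
      constant 0 gives its image.\<close>
    have "\<bar>A (\<lambda>x. 0) x\<bar> \<le> q * 0 * w x" by (rule bound) (auto simp: x)
    then show ?case by (simp add: s_def a_def)
  next
    case (Suc n)
    have "A (s (Suc n)) x = A (\<lambda>x. s n x + a n x) x" by (simp add: s_def)
    also have "\<dots> = A (s n) x + A (a n) x" by (rule add[OF s_cont a_cont x])
    finally show ?case using Suc by (simp add: s_def a_def)
  qed
  show "S x = h x + A S x" if x: "x \<in> X"
  proof -
    have "\<bar>A S x - (s (Suc n) x - h x)\<bar> \<le> q * (q ^ n * c / (1 - q)) * w x" for n
    proof -
      have "A S x = A (\<lambda>x. (S x - s n x) + s n x) x" by simp
      also have "\<dots> = A (\<lambda>x. S x - s n x) x + A (s n) x"
        by (rule add[OF _ s_cont x]) (intro continuous_intros S_cont s_cont)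
      finally have "A S x - (s (Suc n) x - h x) = A (\<lambda>x. S x - s n x) x" using A_s[OF x] by simp
      moreover have "\<bar>A (\<lambda>x. S x - s n x) x\<bar> \<le> q * (q ^ n * c / (1 - q)) * w x"
        using q c by (intro bound x remainder continuous_intros S_cont s_cont) auto
      ultimately show ?thesis by simp
    qed
    then have "norm (A S x - (s (Suc n) x - h x)) \<le> q * (q ^ n * c / (1 - q)) * w x" for n
      by simp
    moreover have "(\<lambda>n. q * (q ^ n * c / (1 - q)) * w x) \<longlonglongrightarrow> q * (0 * c / (1 - q)) * w x"
      using q by (intro tendsto_intros LIMSEQ_realpow_zero) auto
    then have "(\<lambda>n. q * (q ^ n * c / (1 - q)) * w x) \<longlonglongrightarrow> 0" by simp
    ultimately have "(\<lambda>n. A S x - (s (Suc n) x - h x)) \<longlonglongrightarrow> 0"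
      by (rule Lim_null_comparison[OF always_eventually[OF allI]])
    moreover have "(\<lambda>n. A S x - (s (Suc n) x - h x)) \<longlonglongrightarrow> A S x - (S x - h x)"
    proof (intro tendsto_intros)
      show "(\<lambda>n. s (Suc n) x) \<longlonglongrightarrow> S x"
        using summable_LIMSEQ[OF sm[OF x]] by (subst filterlim_sequentially_Suc) (simp add: S s_def)
    qed
    ultimately have "A S x - (S x - h x) = 0" by (rule LIMSEQ_unique[symmetric])
    then show ?thesis by simp
  qed
qed

end

section \<open>Sonine pairs\<close>

lemma continuous_on_Icc_bounded:
  fixes \<phi> :: "real \<Rightarrow> real"
  assumes "continuous_on {a..b} \<phi>"
  obtains B where "0 \<le> B" "\<And>x. a \<le> x \<Longrightarrow> x \<le> b \<Longrightarrow> \<bar>\<phi> x\<bar> \<le> B"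
proof -
  have "bounded (\<phi> ` {a..b})"
    using assms by (intro compact_imp_bounded compact_continuous_image) auto
  then obtain B where "0 < B" "\<And>x. x \<in> {a..b} \<Longrightarrow> \<bar>\<phi> x\<bar> \<le> B"
    by (auto simp: bounded_pos)
  then show ?thesis using that[of B] by auto
qed

lemma set_integrable_mult_bounded:
  fixes f \<phi> :: "real \<Rightarrow> real"
  assumes f: "set_integrable lborel S f" and \<phi>: "set_borel_measurable lborel S \<phi>"
    and B: "\<And>x. x \<in> S \<Longrightarrow> \<bar>\<phi> x\<bar> \<le> B"
  shows "set_integrable lborel S (\<lambda>x. f x * \<phi> x)"
proof (rule set_integrable_bound)
  show "set_integrable lborel S (\<lambda>x. B * f x)" using f by simp
  have [measurable]: "(\<lambda>x. indicator S x * f x) \<in> borel_measurable lborel" "(\<lambda>x. indicator S x * \<phi> x) \<in> borel_measurable lborel"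
    using f \<phi> by (auto simp: set_integrable_def set_borel_measurable_def)
  have "indicator S x *\<^sub>R (f x * \<phi> x) = (indicator S x * f x) * (indicator S x * \<phi> x)" for x
    by (auto simp: indicator_def)
  then have "(\<lambda>x. indicator S x *\<^sub>R (f x * \<phi> x)) = (\<lambda>x. (indicator S x * f x) * (indicator S x * \<phi> x))"
    by (rule ext)
  then show "set_borel_measurable lborel S (\<lambda>x. f x * \<phi> x)"
    unfolding set_borel_measurable_def by (simp only:) measurable
  show "AE x in lborel. x \<in> S \<longrightarrow> norm (f x * \<phi> x) \<le> norm (B * f x)"
  proof (intro AE_I2 impI)
    fix x assume "x \<in> S"
    then have "\<bar>\<phi> x\<bar> \<le> \<bar>B\<bar>" using B[of x] by linarith
    then show "norm (f x * \<phi> x) \<le> norm (B * f x)"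
      by (simp add: abs_mult mult_mono mult.commute)
  qed
qed

lemma set_integrable_mult_continuous:
  fixes f \<phi> :: "real \<Rightarrow> real"
  assumes f: "set_integrable lborel {0<..<x} f" and \<phi>: "continuous_on {0..x} \<phi>"
  shows "set_integrable lborel {0<..<x} (\<lambda>t. f t * \<phi> t)"
proof -
  obtain B where "\<And>t. 0 \<le> t \<Longrightarrow> t \<le> x \<Longrightarrow> \<bar>\<phi> t\<bar> \<le> B" by (rule continuous_on_Icc_bounded[OF \<phi>]) auto
  moreover have "continuous_on {0<..<x} \<phi>"
    by (rule continuous_on_subset[OF \<phi>]) auto
  ultimately show ?thesis
    using set_measurable_continuous_on[of "{0<..<x}" \<phi>]
    by (intro set_integrable_mult_bounded[OF f, of _ B]) (auto simp: set_borel_measurable_def)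
qed

lemma set_integral_mono_set:
  fixes f :: "real \<Rightarrow> real"
  assumes "set_integrable lborel T f" "S \<subseteq> T" "S \<in> sets borel" "\<And>x. x \<in> T \<Longrightarrow> 0 \<le> f x"
  shows "(LINT x:S|lborel. f x) \<le> (LINT x:T|lborel. f x)"
proof -
  have "set_integrable lborel S f" using assms by (intro set_integrable_subset[of lborel T f S]) auto
  then show ?thesis
    using assms unfolding set_integrable_def set_lebesgue_integral_def
    by (intro integral_mono) (auto simp: indicator_def)
qed

text \<open>The properties of \<open>mubar\<close> and \<open>k\<close> on which the analysis rests;
  the Bernstein function enters only when the locale is interpreted. Together with
  \<open>m_anti\<close>, \<open>m_small\<close> says that \<open>m\<close> tends to 0 at infinity,
  which excludes a \<open>k\<close> that vanishes from some point on.\<close>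

locale sonine_pair =
  fixes m k :: "real \<Rightarrow> real"
  assumes m_meas [measurable]: "m \<in> borel_measurable borel"
    and k_meas [measurable]: "k \<in> borel_measurable borel"
    and m_nonneg: "\<And>x. 0 < x \<Longrightarrow> 0 \<le> m x"
    and k_nonneg: "\<And>x. 0 < x \<Longrightarrow> 0 \<le> k x"
    and m_anti: "\<And>x y. 0 < x \<Longrightarrow> x \<le> y \<Longrightarrow> m y \<le> m x"
    and k_anti: "\<And>x y. 0 < x \<Longrightarrow> x \<le> y \<Longrightarrow> k y \<le> k x"
    and m_int: "\<And>x. 0 < x \<Longrightarrow> set_integrable lborel {0<..<x} m"
    and k_int: "\<And>x. 0 < x \<Longrightarrow> set_integrable lborel {0<..<x} k"
    and m_cont: "continuous_on {0<..} m"
    and m_small: "\<And>e. 0 < e \<Longrightarrow> \<exists>x>0. m x < e"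
    and sonine: "\<And>x. 0 < x \<Longrightarrow> conv m k x = 1"
begin

definition kint :: "real \<Rightarrow> real" where
  "kint x = (LINT s:{0<..<x}|lborel. k s)"

lemma kernel_integrable: "0 < x \<Longrightarrow> set_integrable lborel {0<..<x} (\<lambda>r. m r * k (x - r))"
  by (rule antimono_kernel_integrable) (auto simp: m_nonneg k_nonneg m_anti k_anti m_int k_int)

lemma kernel_mass: "0 < x \<Longrightarrow> (LINT r:{0<..<x}|lborel. m r * k (x - r)) = 1"
  using sonine[of x] conv_commute[of m k x] by (simp add: conv_def mult.commute)

lemma kernel_continuous_integrable:
  "0 < x \<Longrightarrow> x \<le> T \<Longrightarrow> continuous_on {0..T} \<phi> \<Longrightarrow>
    set_integrable lborel {0<..<x} (\<lambda>r. m r * k (x - r) * \<phi> r)"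
  by (rule set_integrable_mult_continuous[OF kernel_integrable]) (auto elim: continuous_on_subset)

section \<open>The operators \<open>K\<close> and \<open>R\<close> on continuous functions\<close>

lemma K_at_0 [simp]: "K_op m k \<phi> 0 = \<phi> 0"
  by (simp add: K_op_def)

lemma K_eq_conv: "0 < x \<Longrightarrow> K_op m k \<phi> x = conv k (\<lambda>r. m r * \<phi> r) x"
  by (simp add: K_op_def conv_def mult_ac)

lemma K_const: "0 \<le> x \<Longrightarrow> K_op m k (\<lambda>_. c) x = c"
  using kernel_mass[of x] by (auto simp: K_op_def)

lemma K_add:
  assumes "continuous_on {0..T} \<phi>" "continuous_on {0..T} \<psi>" "x \<in> {0..T}"
  shows "K_op m k (\<lambda>x. \<phi> x + \<psi> x) x = K_op m k \<phi> x + K_op m k \<psi> x"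
  using set_integral_add(2)[OF kernel_continuous_integrable[of x T \<phi>] kernel_continuous_integrable[of x T \<psi>]] assms
  by (auto simp: K_op_def distrib_left)

lemma K_scale: "K_op m k (\<lambda>x. c * \<phi> x) x = c * K_op m k \<phi> x"
  by (simp add: K_op_def mult.left_commute[of _ c])

lemma K_mono:
  assumes "continuous_on {0..T} \<phi>" "continuous_on {0..T} \<psi>" "x \<in> {0..T}"
    and le: "\<And>x. x \<in> {0..T} \<Longrightarrow> \<bar>\<phi> x\<bar> \<le> \<psi> x"
  shows "\<bar>K_op m k \<phi> x\<bar> \<le> K_op m k \<psi> x"
proof (cases "x = 0")
  case False
  have "\<bar>LINT r:{0<..<x}|lborel. m r * k (x - r) * \<phi> r\<bar> \<le> (LINT r:{0<..<x}|lborel. m r * k (x - r) * \<psi> r)"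
    unfolding set_lebesgue_integral_def
  proof (rule integral_abs_bound_integral)
    fix r
    show "\<bar>indicat_real {0<..<x} r *\<^sub>R (m r * k (x - r) * \<phi> r)\<bar> \<le> indicat_real {0<..<x} r *\<^sub>R (m r * k (x - r) * \<psi> r)"
      using le[of r] m_nonneg[of r] k_nonneg[of "x - r"] assms(3)
      by (auto simp: indicator_def abs_mult intro!: mult_left_mono)
  qed (use assms False kernel_continuous_integrable[of x T] in \<open>auto simp: set_integrable_def\<close>)
  with False show ?thesis by (simp add: K_op_def)
qed (use assms in auto)

text \<open>On \<open>(0, T]\<close> this is \<open>antimono_kernel_continuous\<close>. At 0,
  \<open>K \<phi> x\<close> is an average of \<open>\<phi>\<close> over \<open>(0, x)\<close> by
  \<open>kernel_mass\<close> and so tends to \<open>\<phi> 0\<close>, the value that the definition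
  assigns.\<close>

lemma K_continuous:
  assumes \<phi>: "continuous_on {0..T} \<phi>"
  shows "continuous_on {0..T} (K_op m k \<phi>)"
proof -
  obtain B where B: "\<And>x. 0 \<le> x \<Longrightarrow> x \<le> T \<Longrightarrow> \<bar>\<phi> x\<bar> \<le> B" by (rule continuous_on_Icc_bounded[OF \<phi>]) auto
  have "continuous_on {0<..T} (\<lambda>x. LINT r:{0<..<x}|lborel. m r * k (x - r) * \<phi> r)"
    by (rule antimono_kernel_continuous[where B=B])
      (auto simp: m_nonneg k_nonneg m_anti k_anti m_int k_int m_cont B intro: continuous_on_subset[OF \<phi>])
  then have pos: "continuous_on {0<..T} (K_op m k \<phi>)"
    by (rule continuous_on_eq) (auto simp: K_op_def)
  show ?thesis
    unfolding continuous_on_eq_continuous_within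
  proof
    fix x assume x: "x \<in> {0..T}"
    show "continuous (at x within {0..T}) (K_op m k \<phi>)"
    proof (cases "x = 0")
      case False
      then have "continuous (at x within {0<..T}) (K_op m k \<phi>)"
        using pos x by (auto simp: continuous_on_eq_continuous_within)
      moreover have "at x within {0<..T} = at x within {0..T}"
        using x False by (intro at_within_nhd[where S="{0<..}"]) auto
      ultimately show ?thesis by simp
    next
      case True
      show ?thesis
        unfolding True continuous_within_eps_delta
      proof (intro allI impI)
        fix e :: real assume "0 < e"
        then obtain d where d: "0 < d" "\<And>y. y \<in> {0..T} \<Longrightarrow> dist y 0 < d \<Longrightarrow> dist (\<phi> y) (\<phi> 0) < e / 2"
          using \<phi>[unfolded continuous_on_iff, rule_format, of 0 "e/2"] x True by auto
        show "\<exists>d>0. \<forall>y\<in>{0..T}. dist y 0 < d \<longrightarrow> dist (K_op m k \<phi> y) (K_op m k \<phi> 0) < e"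
        proof (intro exI[of _ d] conjI ballI impI d)
          fix y assume y: "y \<in> {0..T}" "dist y 0 < d"
          have c: "continuous_on {0..y} \<phi>" using \<phi> y by (auto elim: continuous_on_subset)
          have "K_op m k \<phi> y = K_op m k (\<lambda>r. (\<phi> r - \<phi> 0) + \<phi> 0) y" by simp
          also have "\<dots> = K_op m k (\<lambda>r. \<phi> r - \<phi> 0) y + \<phi> 0"
            using y c by (subst K_add[where T=y]) (auto intro!: continuous_intros simp: K_const)
          finally have "dist (K_op m k \<phi> y) (K_op m k \<phi> 0) = \<bar>K_op m k (\<lambda>r. \<phi> r - \<phi> 0) y\<bar>"
            by (simp add: dist_real_def)
          also have "\<dots> \<le> K_op m k (\<lambda>_. e / 2) y"
          proof (rule K_mono[where T=y])
            fix r assume "r \<in> {0..y}"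
            then show "\<bar>\<phi> r - \<phi> 0\<bar> \<le> e / 2" using d(2)[of r] y by (auto simp: dist_real_def)
          qed (use y c in \<open>auto intro!: continuous_intros\<close>)
          also have "\<dots> < e" using y \<open>0 < e\<close> by (simp add: K_const)
          finally show "dist (K_op m k \<phi> y) (K_op m k \<phi> 0) < e" .
        qed
      qed
    qed
  qed
qed

lemma R_eq_conv: "I_R k \<phi> = conv \<phi> k"
  by (auto simp: I_R_def fun_eq_iff)

lemma R_at_0 [simp]: "I_R k \<phi> 0 = 0"
  by (simp add: I_R_def)

lemma R_integrable:
  assumes "continuous_on {0..T} \<phi>" "x \<in> {0..T}"
  shows "set_integrable lborel {0<..<x} (\<lambda>t. \<phi> (x - t) * k t)"
proof (cases "x = 0")
  case False
  have "continuous_on {0..x} (\<lambda>t. \<phi> (x - t))"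
    by (rule continuous_on_compose2[OF assms(1)]) (use assms in \<open>auto intro!: continuous_intros\<close>)
  from set_integrable_mult_continuous[OF k_int this] False assms show ?thesis
    by (simp add: mult.commute)
qed (simp add: set_integrable_def)

lemma R_continuous:
  assumes "continuous_on {0..T} \<phi>"
  shows "continuous_on {0..T} (I_R k \<phi>)"
proof (cases "0 < T")
  case True
  then show ?thesis unfolding R_eq_conv by (intro conv_continuous k_int assms)
next
  case False
  then have "{0..T} \<subseteq> {0}" by auto
  then show ?thesis by (rule continuous_on_subset[rotated]) (rule continuous_on_sing)
qed

lemma R_add:
  assumes "continuous_on {0..T} \<phi>" "continuous_on {0..T} \<psi>" "x \<in> {0..T}"
  shows "I_R k (\<lambda>x. \<phi> x + \<psi> x) x = I_R k \<phi> x + I_R k \<psi> x"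
  using set_integral_add(2)[OF R_integrable[of T \<phi> x] R_integrable[of T \<psi> x]] assms
  by (auto simp: R_eq_conv conv_def distrib_right)

lemma R_scale: "I_R k (\<lambda>x. c * \<phi> x) x = c * I_R k \<phi> x"
  by (simp add: R_eq_conv conv_def mult.assoc)

lemma R_mono:
  assumes "continuous_on {0..T} \<phi>" "continuous_on {0..T} \<psi>" "x \<in> {0..T}"
    and le: "\<And>x. x \<in> {0..T} \<Longrightarrow> \<bar>\<phi> x\<bar> \<le> \<psi> x"
  shows "\<bar>I_R k \<phi> x\<bar> \<le> I_R k \<psi> x"
  unfolding R_eq_conv conv_def set_lebesgue_integral_def
proof (rule integral_abs_bound_integral)
  fix r
  show "\<bar>indicat_real {0<..<x} r *\<^sub>R (\<phi> (x - r) * k r)\<bar> \<le> indicat_real {0<..<x} r *\<^sub>R (\<psi> (x - r) * k r)"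
    using le[of "x - r"] k_nonneg[of r] assms(3)
    by (auto simp: indicator_def abs_mult intro!: mult_right_mono)
qed (use assms R_integrable[of T] in \<open>auto simp: set_integrable_def\<close>)

end

section \<open>Strict inequality \<open>m x * kint x < 1\<close> and its uniform form\<close>

context sonine_pair
begin

lemma kernel_integrable': "0 < x \<Longrightarrow> set_integrable lborel {0<..<x} (\<lambda>t. m (x - t) * k t)"
  using set_lborel_reflect(1)[of x "\<lambda>r. m r * k (x - r)"] kernel_integrable[of x] by simp

lemma kint_eq: "kint x = I_R k (\<lambda>_. 1) x"
  by (simp add: R_eq_conv kint_def conv_def)

lemma kint_continuous: "continuous_on {0..T} kint"
  using R_continuous[of T "\<lambda>_. 1"] by (simp add: kint_eq[abs_def])

lemma kint_nonneg: "0 \<le> kint x"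
  unfolding kint_def set_lebesgue_integral_def
  by (rule integral_nonneg_AE) (auto simp: indicator_def k_nonneg)

lemma kint_0 [simp]: "kint 0 = 0"
  by (simp add: kint_eq)

text \<open>If \<open>k\<close> vanished from \<open>c\<close> on, the Sonine identity at \<open>x + c\<close> would give
  \<open>1 \<le> m x * kint c\<close>, although \<open>m\<close> takes arbitrarily small values.\<close>
lemma k_pos:
  assumes c: "0 < c"
  shows "0 < k c"
proof (rule ccontr)
  assume "\<not> 0 < k c"
  then have k0: "k t = 0" if "c \<le> t" for t
    using k_anti[OF c that] k_nonneg[of t] c that by auto
  obtain x where x: "0 < x" "m x < 1 / (kint c + 1)"
    using m_small[of "1 / (kint c + 1)"] kint_nonneg[of c] by auto
  have "1 = conv m k (x + c)" using x c by (simp add: sonine)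
  also have "\<dots> \<le> (\<integral>t. indicator {0<..<c} t *\<^sub>R (m x * k t) \<partial>lborel)"
    unfolding conv_def set_lebesgue_integral_def
  proof (rule integral_mono)
    fix t
    show "indicator {0<..<x + c} t *\<^sub>R (m (x + c - t) * k t) \<le> indicator {0<..<c} t *\<^sub>R (m x * k t)"
      using k0[of t] m_anti[of x "x + c - t"] k_nonneg[of t] x
      by (cases "t < c") (auto simp: indicator_def intro!: mult_right_mono)
  qed (use kernel_integrable'[of "x + c"] set_integrable_mult_right[OF k_int[OF c]] x c
      in \<open>auto simp: set_integrable_def\<close>)
  also have "\<dots> = m x * kint c"
    by (simp add: kint_def set_lebesgue_integral_def mult.left_commute[of _ "m x"])
  also have "\<dots> \<le> m x * (kint c + 1)" using m_nonneg[OF x(1)] by (intro mult_left_mono) auto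
  also have "\<dots> < 1" using x kint_nonneg[of c] by (simp add: field_simps)
  finally show False by simp
qed

lemma kint_pos:
  assumes "0 < x"
  shows "0 < kint x"
proof -
  have "0 < x * k x" using assms k_pos by simp
  also have "x * k x = (LINT t:{0<..<x}|lborel. k x)"
    using assms by (simp add: set_lebesgue_integral_def)
  also have "\<dots> \<le> kint x"
    unfolding kint_def
    by (rule set_integral_mono)
      (use assms k_int k_anti in \<open>auto simp: set_integrable_def\<close>)
  finally show ?thesis .
qed

text \<open>As \<open>m\<close> decreases, \<open>m x * kint x \<le> conv m k x = 1\<close>.
  Positivity of \<open>k\<close> makes this strict once \<open>m\<close> exceeds \<open>m x\<close>
  somewhere on \<open>(0, x)\<close>. If it did not, the Sonine identity at a small \<open>y\<close>
  would give \<open>1 \<le> m x * kint y\<close>, although \<open>kint y\<close> tends to 0 with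
  \<open>y\<close>.\<close>

lemma m_kint_less_1:
  assumes x: "0 < x"
  shows "m x * kint x < 1"
proof -
  have "(kint \<longlongrightarrow> kint 0) (at 0 within {0..x})"
    using kint_continuous[of x, unfolded continuous_on_def, rule_format, of 0] x by simp
  then have "((\<lambda>y. m x * kint y) \<longlongrightarrow> m x * kint 0) (at 0 within {0..x})"
    by (intro tendsto_intros)
  then have "\<forall>\<^sub>F y in at 0 within {0..x}. m x * kint y < 1"
    by (rule order_tendstoD) simp
  then obtain d where d: "0 < d" "\<And>y. y \<in> {0..x} \<Longrightarrow> y \<noteq> 0 \<Longrightarrow> \<bar>y\<bar> < d \<Longrightarrow> m x * kint y < 1"
    by (auto simp: eventually_at dist_real_def)
  define y where "y = min x (d/2)"
  have y: "0 < y" "y \<le> x" "m x * kint y < 1"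
    using x d(1) by (auto simp: y_def intro!: d(2))
  have "\<exists>t. 0 < t \<and> t < x \<and> m x < m t"
  proof (rule ccontr)
    assume "\<nexists>t. 0 < t \<and> t < x \<and> m x < m t"
    then have le: "m t \<le> m x" if "0 < t" "t < y" for t using that y by force
    have "1 = conv m k y" using y by (simp add: sonine)
    also have "\<dots> \<le> (LINT t:{0<..<y}|lborel. m x * k t)"
      unfolding conv_def
      by (rule set_integral_mono)
        (use y kernel_integrable' k_int le k_nonneg in \<open>auto intro!: mult_right_mono\<close>)
    also have "\<dots> = m x * kint y" by (simp add: kint_def)
    finally show False using y by simp
  qed
  then obtain s where s: "0 < s" "s < x" "m x < m s" by blast
  \<comment> \<open>An explicit gap: for \<open>x - s < t < x\<close> the argument
    \<open>x - t\<close> lies below \<open>s\<close>, so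
    \<open>m (x - t) - m x \<ge> m s - m x > 0\<close>, while
    \<open>k t \<ge> k x > 0\<close>.\<close>
  have "s * ((m s - m x) * k x) = (LINT t:{x - s<..<x}|lborel. (m s - m x) * k x)"
    using s by (simp add: set_lebesgue_integral_def)
  also have "\<dots> \<le> (LINT t:{0<..<x}|lborel. m (x - t) * k t - m x * k t)"
    unfolding set_lebesgue_integral_def
  proof (rule integral_mono)
    fix t
    show "indicator {x - s<..<x} t *\<^sub>R ((m s - m x) * k x) \<le> indicator {0<..<x} t *\<^sub>R (m (x - t) * k t - m x * k t)"
    proof (cases "0 < t \<and> t < x")
      case True
      then have "0 \<le> (m (x - t) - m x) * k t"
        using m_anti[of "x - t" x] k_nonneg[of t] by simp
      moreover have "(m s - m x) * k x \<le> (m (x - t) - m x) * k t" if "x - s < t"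
        using that True s m_anti[of "x - t" s] k_anti[of t x] k_nonneg[of x] x by (intro mult_mono) auto
      ultimately show ?thesis using True by (auto simp: indicator_def algebra_simps)
    qed (use s in \<open>auto simp: indicator_def\<close>)
  qed (use s set_integral_diff(1)[OF kernel_integrable'[OF x] set_integrable_mult_right[OF k_int[OF x]]]
      in \<open>auto simp: set_integrable_def\<close>)
  also have "\<dots> = conv m k x - m x * kint x"
    unfolding conv_def kint_def
    by (subst set_integral_diff(2)[OF kernel_integrable'[OF x] set_integrable_mult_right[OF k_int[OF x]]]) simp
  finally have "s * ((m s - m x) * k x) \<le> 1 - m x * kint x" using x by (simp add: sonine)
  moreover have "0 < s * ((m s - m x) * k x)" using s k_pos[OF x] by simp
  ultimately show ?thesis by simp
qed

text \<open>The limes superior settles a neighbourhood of 0. What remains lies in a compact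
  interval, where the continuous function \<open>m x * kint x\<close> attains a maximum, below 1 by
  \<open>m_kint_less_1\<close>.\<close>

lemma m_kint_bounded_away:
  assumes lim: "Limsup (at_right 0) (\<lambda>x. ereal (m x * kint x)) < 1"
  shows "\<exists>\<rho>. 0 \<le> \<rho> \<and> \<rho> < 1 \<and> (\<forall>x. 0 < x \<longrightarrow> x \<le> T \<longrightarrow> m x * kint x \<le> \<rho>)"
proof -
  obtain c where c: "Limsup (at_right 0) (\<lambda>x. ereal (m x * kint x)) < ereal c" "c < 1"
    using ereal_dense2[OF lim] by auto
  obtain d where d: "0 < d" "\<And>x. 0 < x \<Longrightarrow> x < d \<Longrightarrow> m x * kint x < c"
    using Limsup_lessD[OF c(1)] by (auto simp: eventually_at_right_field)
  \<comment> \<open>The maximum keeps the compact interval nonempty even if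
    \<open>T < d/2\<close>.\<close>
  define M where "M = max (d/2) T"
  have "continuous_on {d/2..M} (\<lambda>x. m x * kint x)"
    using d(1) by (intro continuous_intros continuous_on_subset[OF m_cont] continuous_on_subset[OF kint_continuous[of M]]) auto
  then obtain z where z: "z \<in> {d/2..M}" "\<And>x. x \<in> {d/2..M} \<Longrightarrow> m x * kint x \<le> m z * kint z"
    using continuous_attains_sup[of "{d/2..M}" "\<lambda>x. m x * kint x"] by (auto simp: M_def)
  show ?thesis
  proof (intro exI[of _ "max c (m z * kint z)"] conjI allI impI)
    show "0 \<le> max c (m z * kint z)"
      using m_nonneg[of z] kint_nonneg[of z] z(1) d(1) by (auto simp: le_max_iff_disj)
    show "max c (m z * kint z) < 1"
      using m_kint_less_1[of z] z(1) d(1) c by auto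
    show "m x * kint x \<le> max c (m z * kint z)" if "0 < x" "x \<le> T" for x
      using d(2)[of x] z(2)[of x] that d(1) by (cases "x < d/2") (auto simp: M_def le_max_iff_disj)
  qed
qed

end

section \<open>The censored integral\<close>

locale censored_sonine_pair = sonine_pair +
  fixes T \<rho> :: real
  assumes T_pos: "0 < T" and rho: "0 \<le> \<rho>" "\<rho> < 1"
    and m_kint_le: "\<And>x. 0 < x \<Longrightarrow> x \<le> T \<Longrightarrow> m x * kint x \<le> \<rho>"
begin

abbreviation K where "K \<equiv> K_op m k"
abbreviation R where "R \<equiv> I_R k"
abbreviation J where "J \<equiv> I_Ce m k"

text \<open>For \<open>b = 0\<close> this is \<open>kint\<close>, the weight for fixed points of
  \<open>K\<close>; large \<open>b\<close> serve to absorb \<open>lam\<close>.\<close>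

definition w :: "real \<Rightarrow> real \<Rightarrow> real" where
  "w b = R (\<lambda>t. exp (b * t))"

text \<open>The Laplace transform of \<open>k\<close> cut off at \<open>x\<close>. It is the ratio
  of \<open>w b x\<close> to \<open>exp (b * x)\<close>, and the source of the small factor in the
  contraction \<open>lam * J\<close>.\<close>

definition damped :: "real \<Rightarrow> real \<Rightarrow> real" where
  "damped b x = (LINT t:{0<..<x}|lborel. exp (- (b * t)) * k t)"

lemma damped_integrable: 
  assumes "0 < x"
  shows "set_integrable lborel {0<..<x} (\<lambda>t. exp (- (b * t)) * k t)"
proof -
  have "continuous_on {0..x} (\<lambda>t. exp (- (b * t)))" by (intro continuous_intros)
  from set_integrable_mult_continuous[OF k_int[OF assms] this] show ?thesis
    by (simp add: mult.commute)
qed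

lemma w_eq: "w b x = exp (b * x) * damped b x"
  by (simp add: w_def R_eq_conv conv_def damped_def right_diff_distrib exp_diff exp_minus divide_inverse mult_ac
      flip: set_integral_mult_right)

lemma w_continuous: "continuous_on {0..T} (w b)"
  unfolding w_def by (intro R_continuous continuous_intros)

lemma w_at_0 [simp]: "w b 0 = 0"
  by (simp add: w_def)

lemma damped_nonneg: "0 \<le> damped b x"
  unfolding damped_def set_lebesgue_integral_def
  by (rule integral_nonneg_AE) (auto simp: indicator_def k_nonneg)

lemma w_nonneg: "0 \<le> w b x"
  by (simp add: w_eq damped_nonneg)

lemma damped_mono:
  assumes "x \<le> T"
  shows "damped b x \<le> damped b T"
  unfolding damped_def
  by (rule set_integral_mono_set) (use assms damped_integrable[OF T_pos] in \<open>auto simp: k_nonneg\<close>)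

lemma damped_le_kint:
  assumes "0 \<le> b" "0 < x"
  shows "damped b x \<le> kint x"
  unfolding damped_def kint_def
  by (rule set_integral_mono)
    (use assms damped_integrable k_int k_nonneg in \<open>auto intro!: mult_left_le_one_le\<close>)

lemma w_le: "x \<le> T \<Longrightarrow> w b x \<le> damped b T * exp (b * x)"
  using damped_mono[of x b] by (simp add: w_eq mult.commute)

text \<open>\<open>exp (- (n * t))\<close> tends to 0 for each \<open>t > 0\<close>, and
  \<open>k\<close> is an integrable majorant on \<open>(0, T)\<close>. This is what allows
  \<open>lam\<close> of any size on an interval of any length.\<close>

lemma damped_tendsto_0: "(\<lambda>n. damped (real n) T) \<longlonglongrightarrow> 0"
proof -
  have "(\<lambda>n. \<integral>t. indicator {0<..<T} t *\<^sub>R (exp (- (real n * t)) * k t) \<partial>lborel) \<longlonglongrightarrow> integral\<^sup>L lborel (\<lambda>t::real. 0)"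
  proof (rule integral_dominated_convergence[where w="\<lambda>t. indicator {0<..<T} t *\<^sub>R k t"])
    show "integrable lborel (\<lambda>t. indicator {0<..<T} t *\<^sub>R k t)"
      using k_int[OF T_pos] by (simp add: set_integrable_def)
    show "AE t in lborel. (\<lambda>n. indicator {0<..<T} t *\<^sub>R (exp (- (real n * t)) * k t)) \<longlonglongrightarrow> 0"
    proof (intro AE_I2)
      fix t :: real
      show "(\<lambda>n. indicator {0<..<T} t *\<^sub>R (exp (- (real n * t)) * k t)) \<longlonglongrightarrow> 0"
      proof (cases "0 < t")
        case True
        have "(\<lambda>n. exp (- t) ^ n) \<longlonglongrightarrow> 0" using True by (intro LIMSEQ_realpow_zero) auto
        then have "(\<lambda>n. exp (- (real n * t))) \<longlonglongrightarrow> 0"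
          by (simp flip: exp_of_nat_mult)
        then have "(\<lambda>n. indicator {0<..<T} t *\<^sub>R (exp (- (real n * t)) * k t)) \<longlonglongrightarrow> indicator {0<..<T} t *\<^sub>R (0 * k t)"
          by (intro tendsto_intros)
        then show ?thesis by simp
      qed auto
    qed
    show "AE t in lborel. norm (indicator {0<..<T} t *\<^sub>R (exp (- (real n * t)) * k t)) \<le> indicator {0<..<T} t *\<^sub>R k t" for n
      by (intro AE_I2) (auto simp: indicator_def abs_mult k_nonneg intro!: mult_left_le_one_le)
  qed auto
  then show ?thesis by (simp add: damped_def set_lebesgue_integral_def)
qed

text \<open>Here \<open>m r * w b r = exp (b r) * (m r * damped b r) \<le> \<rho> * exp (b r)\<close>, which turns
  the kernel of \<open>K\<close> into that of \<open>R\<close>.\<close>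
lemma K_w_le:
  assumes b: "0 \<le> b" and x: "x \<in> {0..T}"
  shows "K (w b) x \<le> \<rho> * w b x"
proof (cases "x = 0")
  case False
  then have x0: "0 < x" "x \<le> T" using x by auto
  have "K (w b) x = (LINT r:{0<..<x}|lborel. m r * k (x - r) * w b r)"
    using x0 by (simp add: K_op_def)
  also have "\<dots> \<le> (LINT r:{0<..<x}|lborel. \<rho> * (k (x - r) * exp (b * r)))"
  proof (rule set_integral_mono)
    show "set_integrable lborel {0<..<x} (\<lambda>r. m r * k (x - r) * w b r)"
      by (rule kernel_continuous_integrable[OF x0 w_continuous])
    have "set_integrable lborel {0<..<x} (\<lambda>t. exp (b * (x - t)) * k t)"
      by (rule R_integrable[where T=T and \<phi>="\<lambda>t. exp (b * t)"]) (use x in \<open>auto intro!: continuous_intros\<close>)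
    then show "set_integrable lborel {0<..<x} (\<lambda>r. \<rho> * (k (x - r) * exp (b * r)))"
      using set_lborel_reflect(1)[of x "\<lambda>r. k (x - r) * exp (b * r)"] by (simp add: mult.commute)
    fix r assume r: "r \<in> {0<..<x}"
    have "m r * damped b r \<le> m r * kint r"
      using damped_le_kint[OF b, of r] m_nonneg[of r] r by (intro mult_left_mono) auto
    also have "\<dots> \<le> \<rho>" using m_kint_le r x0 by auto
    finally have "(m r * damped b r) * (k (x - r) * exp (b * r)) \<le> \<rho> * (k (x - r) * exp (b * r))"
      using k_nonneg[of "x - r"] r by (intro mult_right_mono) auto
    then show "m r * k (x - r) * w b r \<le> \<rho> * (k (x - r) * exp (b * r))"
      by (simp add: w_eq mult_ac)
  qed
  also have "\<dots> = \<rho> * conv k (\<lambda>t. exp (b * t)) x"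
    by (simp add: conv_def)
  also have "\<dots> = \<rho> * w b x"
    by (simp add: w_def R_eq_conv conv_commute)
  finally show ?thesis .
qed simp

lemma K_weighted_bound:
  assumes \<phi>: "continuous_on {0..T} \<phi>" "\<And>x. x \<in> {0..T} \<Longrightarrow> \<bar>\<phi> x\<bar> \<le> c * w b x"
    and "0 \<le> b" "0 \<le> c" "x \<in> {0..T}"
  shows "\<bar>K \<phi> x\<bar> \<le> \<rho> * c * w b x"
proof -
  have "\<bar>K \<phi> x\<bar> \<le> K (\<lambda>x. c * w b x) x"
    by (rule K_mono[where T=T]) (use assms in \<open>auto intro!: continuous_intros w_continuous\<close>)
  also have "\<dots> \<le> c * (\<rho> * w b x)"
    unfolding K_scale using assms K_w_le by (intro mult_left_mono) auto
  finally show ?thesis by (simp add: mult_ac)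
qed

lemma R_weighted_bound:
  assumes "continuous_on {0..T} g" "\<And>x. x \<in> {0..T} \<Longrightarrow> \<bar>g x\<bar> \<le> c * exp (b * x)" "x \<in> {0..T}"
  shows "\<bar>R g x\<bar> \<le> c * w b x"
proof -
  have "\<bar>R g x\<bar> \<le> R (\<lambda>x. c * exp (b * x)) x"
    by (rule R_mono[where T=T]) (use assms in \<open>auto intro!: continuous_intros\<close>)
  then show ?thesis by (simp only: R_scale w_def)
qed

lemma w_bounded: "0 \<le> b \<Longrightarrow> x \<in> {0..T} \<Longrightarrow> w b x \<le> damped b T * exp (b * T)"
  by (rule order_trans[OF w_le]) (auto intro!: mult_left_mono damped_nonneg)

text \<open>\<open>R\<close> is positive, so a bound of \<open>g\<close> by
  \<open>c * exp (b * x)\<close> becomes a bound of \<open>R g\<close> by \<open>c * w b x\<close>.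
  Thus the first term of the series already lies in the weighted space where \<open>K\<close>
  contracts.\<close>

lemma
  assumes g: "continuous_on {0..T} g" "\<And>x. x \<in> {0..T} \<Longrightarrow> \<bar>g x\<bar> \<le> c * exp (b * x)"
    and b: "0 \<le> b" and c: "0 \<le> c"
  shows J_summable_weighted: "x \<in> {0..T} \<Longrightarrow> summable (\<lambda>i. (K ^^ i) (R g) x)"
    and J_continuous_weighted: "continuous_on {0..T} (J g)"
    and J_fixed_point_weighted: "x \<in> {0..T} \<Longrightarrow> J g x = R g x + K (J g) x"
    and J_weighted_bound: "x \<in> {0..T} \<Longrightarrow> \<bar>J g x\<bar> \<le> c / (1 - \<rho>) * w b x"
proof -
  interpret N: weighted_contraction "{0..T}" K "w b" "R g" \<rho> c "damped b T * exp (b * T)"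
    by unfold_locales (use b in \<open>blast intro: K_continuous K_add K_weighted_bound rho c w_nonneg
      w_bounded R_continuous[OF g(1)] R_weighted_bound[OF g]\<close>)+
  have "J g = N.S" by (rule ext) (simp add: I_Ce_def N.S_def)
  then show "x \<in> {0..T} \<Longrightarrow> summable (\<lambda>i. (K ^^ i) (R g) x)" "continuous_on {0..T} (J g)"
    "x \<in> {0..T} \<Longrightarrow> J g x = R g x + K (J g) x" "x \<in> {0..T} \<Longrightarrow> \<bar>J g x\<bar> \<le> c / (1 - \<rho>) * w b x"
    using N.neumann_series by simp_all
qed

text \<open>A continuous \<open>g\<close> is bounded on \<open>{0..T}\<close>, which is the weighted
  bound with \<open>b = 0\<close>; \<open>J g 0 = 0\<close> because \<open>w 0\<close> vanishes at
  0.\<close>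

lemma
  assumes g: "continuous_on {0..T} g"
  shows J_summable: "x \<in> {0..T} \<Longrightarrow> summable (\<lambda>i. (K ^^ i) (R g) x)"
    and J_continuous: "continuous_on {0..T} (J g)"
    and J_fixed_point: "x \<in> {0..T} \<Longrightarrow> J g x = R g x + K (J g) x"
    and J_at_0: "J g 0 = 0"
proof -
  obtain B where B: "0 \<le> B" "\<And>x. 0 \<le> x \<Longrightarrow> x \<le> T \<Longrightarrow> \<bar>g x\<bar> \<le> B" using continuous_on_Icc_bounded[OF g] by blast
  then have "\<bar>g x\<bar> \<le> B * exp (0 * x)" if "x \<in> {0..T}" for x using that by auto
  note * = g this order_refl B(1)
  show "x \<in> {0..T} \<Longrightarrow> summable (\<lambda>i. (K ^^ i) (R g) x)" by (rule J_summable_weighted[OF *])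
  show "continuous_on {0..T} (J g)" by (rule J_continuous_weighted[OF *])
  show "x \<in> {0..T} \<Longrightarrow> J g x = R g x + K (J g) x" by (rule J_fixed_point_weighted[OF *])
  show "J g 0 = 0" using J_weighted_bound[OF *, of 0] T_pos by simp
qed

lemma K_cong:
  assumes "\<And>x. x \<in> {0..T} \<Longrightarrow> \<phi> x = \<psi> x" "x \<in> {0..T}"
  shows "K \<phi> x = K \<psi> x"
  using assms by (auto simp: K_op_def intro!: set_lebesgue_integral_cong)

lemma K_power_continuous: "continuous_on {0..T} \<phi> \<Longrightarrow> continuous_on {0..T} ((K ^^ i) \<phi>)"
  by (induction i) (auto intro: K_continuous)

text \<open>Formulated for an \<open>\<eta>\<close> that agrees with the sum on
  \<open>{0..T}\<close>, since \<open>R_add\<close> provides equality of values there and not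
  equality of functions.\<close>

lemma K_power_add:
  assumes "continuous_on {0..T} \<phi>" "continuous_on {0..T} \<psi>"
    and "\<And>x. x \<in> {0..T} \<Longrightarrow> \<eta> x = \<phi> x + \<psi> x"
  shows "x \<in> {0..T} \<Longrightarrow> (K ^^ i) \<eta> x = (K ^^ i) \<phi> x + (K ^^ i) \<psi> x"
proof (induction i arbitrary: x)
  case (Suc i)
  have "K ((K ^^ i) \<eta>) x = K (\<lambda>x. (K ^^ i) \<phi> x + (K ^^ i) \<psi> x) x"
    using Suc by (intro K_cong) auto
  then show ?case
    using K_add[OF K_power_continuous[OF assms(1)] K_power_continuous[OF assms(2)] Suc.prems] by simp
qed (use assms in auto)

lemma J_add:
  assumes "continuous_on {0..T} \<phi>" "continuous_on {0..T} \<psi>" "x \<in> {0..T}"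
  shows "J (\<lambda>x. \<phi> x + \<psi> x) x = J \<phi> x + J \<psi> x"
proof -
  have "(K ^^ i) (R (\<lambda>x. \<phi> x + \<psi> x)) x = (K ^^ i) (R \<phi>) x + (K ^^ i) (R \<psi>) x" for i
    by (rule K_power_add[OF R_continuous[OF assms(1)] R_continuous[OF assms(2)] R_add[OF assms(1,2)] assms(3)])
  then show ?thesis
    using suminf_add[OF J_summable[OF assms(1,3)] J_summable[OF assms(2,3)]] by (simp add: I_Ce_def)
qed

section \<open>Existence and uniqueness for the integral equation\<close>

lemma obtain_weight:
  obtains b q where "0 \<le> b" "0 \<le> q" "q < 1" "\<bar>lam\<bar> * (damped b T / (1 - \<rho>)) \<le> q"
proof -
  have "(\<lambda>n. \<bar>lam\<bar> * (damped (real n) T / (1 - \<rho>))) \<longlonglongrightarrow> \<bar>lam\<bar> * (0 / (1 - \<rho>))"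
    using rho by (intro tendsto_intros damped_tendsto_0) auto
  then have "\<forall>\<^sub>F n in sequentially. \<bar>lam\<bar> * (damped (real n) T / (1 - \<rho>)) < 1"
    by (rule order_tendstoD) simp
  then obtain n where "\<bar>lam\<bar> * (damped (real n) T / (1 - \<rho>)) < 1"
    by (auto simp: eventually_sequentially)
  then show ?thesis
    using rho damped_nonneg[of "real n" T] by (intro that[of "real n" "\<bar>lam\<bar> * (damped (real n) T / (1 - \<rho>))"]) auto
qed

lemma lam_J_weighted_bound:
  assumes g: "continuous_on {0..T} g" "\<And>x. x \<in> {0..T} \<Longrightarrow> \<bar>g x\<bar> \<le> c * exp (b * x)"
    and "0 \<le> b" and c: "0 \<le> c" and q: "\<bar>lam\<bar> * (damped b T / (1 - \<rho>)) \<le> q" and x: "x \<in> {0..T}"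
  shows "\<bar>lam * J g x\<bar> \<le> q * c * exp (b * x)"
proof -
  have "\<bar>J g x\<bar> \<le> c / (1 - \<rho>) * w b x" by (rule J_weighted_bound) (use assms in auto)
  also have "\<dots> \<le> c / (1 - \<rho>) * (damped b T * exp (b * x))"
    using x c rho by (intro mult_left_mono w_le) auto
  finally have "\<bar>lam * J g x\<bar> \<le> \<bar>lam\<bar> * (c / (1 - \<rho>) * (damped b T * exp (b * x)))"
    unfolding abs_mult by (intro mult_left_mono) auto
  also have "\<dots> = (\<bar>lam\<bar> * (damped b T / (1 - \<rho>))) * (c * exp (b * x))" by simp
  also have "\<dots> \<le> q * (c * exp (b * x))" using q c by (intro mult_right_mono) auto
  finally show ?thesis by simp
qed

definition solution :: "real \<Rightarrow> real \<Rightarrow> real" where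
  "solution lam x = (\<Sum>i. ((\<lambda>g y. lam * J g y) ^^ i) (\<lambda>_. 1) x)"

lemma
  shows solution_summable: "x \<in> {0..T} \<Longrightarrow> summable (\<lambda>i. ((\<lambda>g y. lam * J g y) ^^ i) (\<lambda>_. 1) x)"
    and solution_continuous: "continuous_on {0..T} (solution lam)"
    and solution_J: "x \<in> {0..T} \<Longrightarrow> solution lam x = 1 + lam * J (solution lam) x"
proof -
  obtain b q where b: "0 \<le> b" "0 \<le> q" "q < 1" "\<bar>lam\<bar> * (damped b T / (1 - \<rho>)) \<le> q"
    by (rule obtain_weight)
  interpret N: weighted_contraction "{0..T}" "\<lambda>g y. lam * J g y" "\<lambda>x. exp (b * x)" "\<lambda>_. 1" q 1 "exp (b * T)"
  proof
    show "continuous_on {0..T} (\<lambda>y. lam * J \<phi> y)" if "continuous_on {0..T} \<phi>" for \<phi>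
      using J_continuous[OF that] by (intro continuous_intros)
    show "lam * J (\<lambda>x. \<phi> x + \<psi> x) x = lam * J \<phi> x + lam * J \<psi> x"
      if "continuous_on {0..T} \<phi>" "continuous_on {0..T} \<psi>" "x \<in> {0..T}" for \<phi> \<psi> x
      using J_add[OF that] by (simp add: distrib_left)
    show "\<bar>lam * J \<phi> x\<bar> \<le> q * c * exp (b * x)"
      if "continuous_on {0..T} \<phi>" "0 \<le> c" "\<And>x. x \<in> {0..T} \<Longrightarrow> \<bar>\<phi> x\<bar> \<le> c * exp (b * x)" "x \<in> {0..T}" for \<phi> c x
      by (rule lam_J_weighted_bound) (use that b in auto)
  qed (use b in \<open>auto intro!: mult_left_mono\<close>)
  have "solution lam = N.S" by (rule ext) (simp add: solution_def N.S_def)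
  then show "x \<in> {0..T} \<Longrightarrow> summable (\<lambda>i. ((\<lambda>g y. lam * J g y) ^^ i) (\<lambda>_. 1) x)"
    "continuous_on {0..T} (solution lam)" "x \<in> {0..T} \<Longrightarrow> solution lam x = 1 + lam * J (solution lam) x"
    using N.neumann_series by simp_all
qed

lemma solution_at_0: "solution lam 0 = 1"
  using solution_J[of 0 lam] J_at_0[OF solution_continuous] T_pos by simp

text \<open>Write \<open>S\<close> for the solution. Inserting \<open>J S = R S + K (J S)\<close>
  into \<open>S - 1 = lam * J S\<close> produces the term
  \<open>K (lam * J S) = K (S - 1) = K S - 1\<close>, and the constants cancel because
  \<open>K\<close> fixes them.\<close>

lemma solution_fixed_point:
  assumes x: "x \<in> {0..T}"
  shows "solution lam x = K (solution lam) x + lam * R (solution lam) x"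
proof -
  let ?S = "solution lam"
  have "?S x - 1 = lam * R ?S x + lam * K (J ?S) x"
    using solution_J[OF x, of lam] J_fixed_point[OF solution_continuous x, of lam] by (simp add: distrib_left)
  also have "lam * K (J ?S) x = K (\<lambda>x. lam * J ?S x) x" by (simp add: K_scale)
  also have "\<dots> = K (\<lambda>x. ?S x + (- 1)) x"
    by (rule K_cong[OF _ x]) (simp add: solution_J)
  also have "\<dots> = K ?S x - 1"
    using K_add[OF solution_continuous continuous_on_const x, of lam "- 1"] K_const[of x "- 1"] x by simp
  finally show ?thesis by simp
qed

text \<open>The bound \<open>\<bar>D\<bar> \<le> e + C * w 0\<close>, available for each \<open>e > 0\<close> because \<open>D\<close> vanishes at \<open>0\<close>,
  improves under iteration of \<open>K\<close> to \<open>e + C * \<rho> ^ n * w 0\<close>.\<close>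
lemma K_fixed_point_unique:
  assumes D: "continuous_on {0..T} D" "D 0 = 0" and fp: "\<And>x. x \<in> {0..T} \<Longrightarrow> D x = K D x"
    and x: "x \<in> {0..T}"
  shows "D x = 0"
proof -
  obtain M where M: "0 \<le> M" "\<And>x. 0 \<le> x \<Longrightarrow> x \<le> T \<Longrightarrow> \<bar>D x\<bar> \<le> M" using continuous_on_Icc_bounded[OF D(1)] by blast
  have w0: "w 0 x = kint x" for x by (simp add: w_def kint_eq)
  have "\<bar>D x\<bar> \<le> e" if "0 < e" for e
  proof -
    obtain d where d: "0 < d" "\<And>y. y \<in> {0..T} \<Longrightarrow> \<bar>y\<bar> < d \<Longrightarrow> \<bar>D y\<bar> < e"
      using D(1)[unfolded continuous_on_iff, rule_format, of 0 e] D(2) T_pos \<open>0 < e\<close>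
      by (auto simp: dist_real_def)
    \<comment> \<open>\<open>w 0 = kint\<close> is increasing, so from \<open>d\<close> on the term
      \<open>C * w 0 y\<close> is at least \<open>M\<close>, which bounds
      \<open>\<bar>D\<bar>\<close>; before \<open>d\<close> the term \<open>e\<close>
      suffices.\<close>
    define C where "C = M / kint d"
    have C: "0 \<le> C" "C * kint d = M" using kint_pos[OF d(1)] M by (auto simp: C_def)
    have start: "\<bar>D y\<bar> \<le> e + C * w 0 y" if y: "y \<in> {0..T}" for y
    proof (cases "y < d")
      case True
      then show ?thesis using d(2)[OF y] y C mult_nonneg_nonneg[OF C(1) w_nonneg[of 0 y]] by auto
    next
      case False
      then have "kint d \<le> w 0 y"
        unfolding w0 kint_def using d(1) y k_int[of y] by (intro set_integral_mono_set) (auto simp: k_nonneg)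
      then have "C * kint d \<le> C * w 0 y" using C by (intro mult_left_mono) auto
      then show ?thesis using M(2)[of y] y C \<open>0 < e\<close> by auto
    qed
    have iter: "\<bar>D y\<bar> \<le> e + (C * \<rho> ^ n) * w 0 y" if "y \<in> {0..T}" for n y
      using that
    proof (induction n arbitrary: y)
      case (Suc n)
      have cw: "continuous_on {0..T} (\<lambda>y. (C * \<rho> ^ n) * w 0 y)" by (intro continuous_intros w_continuous)
      have "\<bar>D y\<bar> = \<bar>K D y\<bar>" using fp Suc by simp
      also have "\<dots> \<le> K (\<lambda>y. e + (C * \<rho> ^ n) * w 0 y) y"
        by (rule K_mono[where T=T]) (use Suc D cw in \<open>auto intro!: continuous_intros\<close>)
      also have "\<dots> = e + (C * \<rho> ^ n) * K (w 0) y"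
        using K_add[OF continuous_on_const cw Suc.prems, of e] K_const[of y e] Suc.prems K_scale[of "C * \<rho> ^ n" "w 0" y] by simp
      also have "\<dots> \<le> e + (C * \<rho> ^ n) * (\<rho> * w 0 y)"
        using K_w_le[of 0 y] Suc.prems C rho by (intro add_left_mono mult_left_mono) auto
      finally show ?case by (simp add: mult_ac)
    qed (use start in auto)
    have "(\<lambda>n. e + (C * \<rho> ^ n) * w 0 x) \<longlonglongrightarrow> e + (C * 0) * w 0 x"
      using rho by (intro tendsto_intros LIMSEQ_realpow_zero)
    then show ?thesis using iter[OF x] by (intro LIMSEQ_le_const[of _ e]) auto
  qed
  then show ?thesis using field_le_epsilon[of "\<bar>D x\<bar>" 0] by auto
qed

text \<open>Subtracting \<open>lam\<close> times \<open>J D = R D + K (J D)\<close> from the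
  equation removes \<open>R\<close> and shows that \<open>D - lam * J D\<close> is a fixed point of
  \<open>K\<close> with value 0 at 0, hence zero. Then \<open>D = lam * J D\<close>, and iterating
  the contraction from the crude bound \<open>M\<close> leaves only 0.\<close>

lemma integral_equation_unique:
  assumes D: "continuous_on {0..T} D" "D 0 = 0"
    and fp: "\<And>x. x \<in> {0..T} \<Longrightarrow> D x = K D x + lam * R D x" and x: "x \<in> {0..T}"
  shows "D x = 0"
proof -
  have JD: "continuous_on {0..T} (\<lambda>x. (- lam) * J D x)"
    by (intro continuous_intros J_continuous D)
  have eq: "D x = lam * J D x" if x: "x \<in> {0..T}" for x
  proof -
    have "D x + (- lam) * J D x = 0"
    proof (rule K_fixed_point_unique[OF _ _ _ x])
      show "continuous_on {0..T} (\<lambda>x. D x + (- lam) * J D x)" by (intro continuous_intros JD D)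
      show "D 0 + (- lam) * J D 0 = 0" by (simp add: D J_at_0)
      show "D y + (- lam) * J D y = K (\<lambda>x. D x + (- lam) * J D x) y" if y: "y \<in> {0..T}" for y
      proof -
        have "K (\<lambda>x. D x + (- lam) * J D x) y = K D y + (- lam) * K (J D) y"
          unfolding K_add[OF D(1) JD y] K_scale ..
        then show ?thesis using fp[OF y] J_fixed_point[OF D(1) y] by (simp add: algebra_simps)
      qed
    qed
    then show ?thesis by simp
  qed
  obtain b q where b: "0 \<le> b" "0 \<le> q" "q < 1" "\<bar>lam\<bar> * (damped b T / (1 - \<rho>)) \<le> q"
    by (rule obtain_weight)
  obtain M where M: "0 \<le> M" "\<And>x. 0 \<le> x \<Longrightarrow> x \<le> T \<Longrightarrow> \<bar>D x\<bar> \<le> M" using continuous_on_Icc_bounded[OF D(1)] by blast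
  have iter: "\<bar>D y\<bar> \<le> (q ^ n * M) * exp (b * y)" if "y \<in> {0..T}" for n y
    using that
  proof (induction n arbitrary: y)
    case 0
    then show ?case using M b by (auto intro!: order_trans[OF M(2)] simp: mult_le_cancel_left1)
  next
    case (Suc n)
    then have "\<bar>lam * J D y\<bar> \<le> q * (q ^ n * M) * exp (b * y)"
      by (intro lam_J_weighted_bound) (use D b M in auto)
    then show ?case using eq[OF Suc.prems] by (simp add: mult_ac)
  qed
  have "(\<lambda>n. (q ^ n * M) * exp (b * x)) \<longlonglongrightarrow> (0 * M) * exp (b * x)"
    using b by (intro tendsto_intros LIMSEQ_realpow_zero)
  from LIMSEQ_le_const[OF this, of "\<bar>D x\<bar>"] have "\<bar>D x\<bar> \<le> 0" using iter[OF x] by simp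
  then show ?thesis by simp
qed

end

section \<open>The integral equation\<close>

lemma at_within_Ioc_neq_bot: "x \<in> {0<..T} \<Longrightarrow> at x within {0<..T::real} \<noteq> bot"
  by (simp add: trivial_limit_within)

text \<open>\<open>h\<close> may be unbounded at 0, so the fundamental theorem is applied on
  \<open>{a..T}\<close> with \<open>a = x / 2\<close>; the integral over \<open>(0, a)\<close> only
  adds a constant.\<close>

lemma set_integral_has_real_derivative:
  fixes h :: "real \<Rightarrow> real"
  assumes int: "set_integrable lborel {0<..<T} h" and cont: "continuous_on {0<..T} h" and x: "x \<in> {0<..T}"
  shows "((\<lambda>x. LINT s:{0<..<x}|lborel. h s) has_real_derivative h x) (at x within {0<..T})"
proof -
  define a where "a = x / 2"
  have a: "0 < a" "a < x" using x by (auto simp: a_def)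
  have HK: "(LINT s:{0<..<y}|lborel. h s) = integral {0..y} h" "h integrable_on {0..y}" if "y \<le> T" for y
  proof -
    have "set_integrable lborel {0<..<y} h"
      by (rule set_integrable_subset[OF int]) (use that in auto)
    from set_borel_integral_eq_integral[OF this]
    show "(LINT s:{0<..<y}|lborel. h s) = integral {0..y} h" "h integrable_on {0..y}"
      by (simp_all add: integral_open_interval_real integrable_on_open_interval_real)
  qed
  have eq: "integral {0..a} h + integral {a..y} h = (LINT s:{0<..<y}|lborel. h s)" if "a \<le> y" "y \<le> T" for y
    using HK[OF that(2)] Henstock_Kurzweil_Integration.integral_combine[of 0 a y h] a that by simp
  have "((\<lambda>u. integral {a..u} h) has_real_derivative h x) (at x within {a..T})"
    by (rule integral_has_real_derivative) (use a x in \<open>auto intro: continuous_on_subset[OF cont]\<close>)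
  then have "((\<lambda>u. integral {0..a} h + integral {a..u} h) has_real_derivative h x) (at x within {a..T})"
    by (auto intro!: derivative_eq_intros)
  then have "((\<lambda>x. LINT s:{0<..<x}|lborel. h s) has_real_derivative h x) (at x within {a..T})"
    by (rule has_field_derivative_transform_within[where d=1]) (use x a eq in auto)
  moreover have "at x within {a..T} = at x within {0<..T}"
    by (rule at_within_nhd[where S="{a<..}"]) (use a in auto)
  ultimately show ?thesis by simp
qed

lemma zero_if_set_integral_zero:
  fixes h :: "real \<Rightarrow> real"
  assumes int: "set_integrable lborel {0<..<T} h" and cont: "continuous_on {0<..T} h"
    and zero: "\<And>x. x \<in> {0<..T} \<Longrightarrow> (LINT s:{0<..<x}|lborel. h s) = 0" and x: "x \<in> {0<..T}"
  shows "h x = 0"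
proof -
  have "((\<lambda>_. 0) has_real_derivative h x) (at x within {0<..T})"
    by (rule has_field_derivative_transform_within[OF set_integral_has_real_derivative[OF int cont x], of 1])
      (use zero x in auto)
  moreover have "((\<lambda>_. 0) has_real_derivative 0) (at x within {0<..T})" by (rule DERIV_const)
  ultimately show ?thesis
    unfolding has_real_derivative_iff_has_vector_derivative
    by (rule vector_derivative_unique_within[OF at_within_Ioc_neq_bot[OF x]])
qed

lemma continuous_on_imp_set_integrable_Ioo:
  fixes f :: "real \<Rightarrow> real"
  shows "continuous_on {a..b} f \<Longrightarrow> set_integrable lborel {a<..<b} f"
  by (rule set_integrable_subset[OF borel_integrable_atLeastAtMost']) auto

lemma conv_1: "conv (\<lambda>_. 1) h x = (LINT s:{0<..<x}|lborel. h s)"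
  by (simp add: conv_def)

lemma set_borel_measurable_if_integrable:
  "set_integrable lborel S h \<Longrightarrow> set_borel_measurable lborel S h"
  unfolding set_integrable_def set_borel_measurable_def by (rule borel_measurable_integrable)

section \<open>Equivalence of the initial value problem and the integral equation\<close>

context censored_sonine_pair
begin

context
  fixes \<phi> :: "real \<Rightarrow> real" and lam :: real
  assumes \<phi>: "continuous_on {0..T} \<phi>"
begin

text \<open>The value that the differential equation prescribes for the derivative of
  \<open>conv m \<phi>\<close>; possibly singular at 0 like \<open>m\<close>, but
  integrable.\<close>

definition forcing :: "real \<Rightarrow> real" where
  "forcing r = m r * \<phi> r + lam * \<phi> r"

lemma m_phi_integrable: "x \<in> {0<..T} \<Longrightarrow> set_integrable lborel {0<..<x} (\<lambda>r. m r * \<phi> r)"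
  by (rule set_integrable_mult_continuous[OF m_int]) (auto intro: continuous_on_subset[OF \<phi>])

lemma forcing_integrable: "x \<in> {0<..T} \<Longrightarrow> set_integrable lborel {0<..<x} forcing"
  unfolding forcing_def[abs_def]
  by (intro set_integral_add(1) m_phi_integrable set_integrable_mult_right continuous_on_imp_set_integrable_Ioo)
    (auto intro: continuous_on_subset[OF \<phi>])

lemma forcing_continuous: "continuous_on {0<..T} forcing"
  unfolding forcing_def[abs_def]
  by (intro continuous_intros continuous_on_subset[OF m_cont] continuous_on_subset[OF \<phi>]) auto

lemma conv_k_forcing:
  assumes x: "x \<in> {0<..T}"
  shows "conv k forcing x = K \<phi> x + lam * R \<phi> x"
proof -
  have 1: "set_integrable lborel {0<..<x} (\<lambda>r. k (x - r) * (m r * \<phi> r))"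
    using kernel_continuous_integrable[of x T \<phi>] \<phi> x by (simp add: mult_ac)
  have 2: "set_integrable lborel {0<..<x} (\<lambda>r. lam * (k (x - r) * \<phi> r))"
    using R_integrable[OF \<phi>, of x] set_lborel_reflect(1)[of x "\<lambda>r. k (x - r) * \<phi> r"] x
    by (simp add: mult.commute)
  have "conv k forcing x = conv k (\<lambda>r. m r * \<phi> r) x + lam * conv k \<phi> x"
    using set_integral_add(2)[OF 1 2] by (simp add: conv_def forcing_def algebra_simps)
  then show ?thesis using x by (simp add: K_eq_conv R_eq_conv conv_commute[of k \<phi>])
qed

lemma forcing_measurable: "x \<in> {0<..T} \<Longrightarrow> set_borel_measurable lborel {0<..<x} forcing"
  by (rule set_borel_measurable_if_integrable[OF forcing_integrable])

text \<open>By \<open>conv_k_forcing\<close> the integral equation reads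
  \<open>\<phi> = conv k forcing\<close>. Convolved with \<open>m\<close>, it exhibits
  \<open>conv m \<phi>\<close> as the primitive of \<open>forcing\<close>, because
  \<open>conv m k\<close> is the constant 1.\<close>

lemma conv_m_if_fixed_point:
  assumes fp: "\<And>x. x \<in> {0..T} \<Longrightarrow> \<phi> x = K \<phi> x + lam * R \<phi> x" and x: "x \<in> {0<..T}"
  shows "conv m \<phi> x = (LINT s:{0<..<x}|lborel. forcing s)"
proof -
  have "conv m \<phi> x = conv m (conv k forcing) x"
    by (rule conv_cong) (use fp conv_k_forcing x in auto)
  also have "\<dots> = conv (conv m k) forcing x"
  proof (rule conv_assoc)
    have "set_integrable lborel {0<..<x} (\<lambda>s. conv m k (x - s) * forcing s) = set_integrable lborel {0<..<x} forcing"
      by (rule set_integrable_cong) (auto simp: sonine)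
    then show "set_integrable lborel {0<..<x} (\<lambda>s. conv m k (x - s) * forcing s)"
      using forcing_integrable[OF x] by simp
  qed (use forcing_measurable[OF x] in \<open>auto intro: m_nonneg k_nonneg kernel_integrable'\<close>)
  also have "\<dots> = conv (\<lambda>_. 1) forcing x"
    by (rule conv_cong) (auto simp: sonine)
  finally show ?thesis by (simp add: conv_1)
qed

lemma conv_k_m_phi:
  assumes x: "x \<in> {0<..T}"
  shows "conv k (conv m \<phi>) x = (LINT s:{0<..<x}|lborel. \<phi> s)"
proof -
  have km: "conv k m y = 1" if "0 < y" for y using sonine[OF that] by (simp add: conv_commute)
  have \<phi>_int: "set_integrable lborel {0<..<x} \<phi>"
    by (rule continuous_on_imp_set_integrable_Ioo) (use x in \<open>auto intro: continuous_on_subset[OF \<phi>]\<close>)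
  have "conv k (conv m \<phi>) x = conv (conv k m) \<phi> x"
  proof (rule conv_assoc)
    have "set_integrable lborel {0<..<x} (\<lambda>s. conv k m (x - s) * \<phi> s) = set_integrable lborel {0<..<x} \<phi>"
      by (rule set_integrable_cong) (auto simp: km)
    then show "set_integrable lborel {0<..<x} (\<lambda>s. conv k m (x - s) * \<phi> s)" using \<phi>_int by simp
    show "set_integrable lborel {0<..<y} (\<lambda>t. k (y - t) * m t)" if "0 < y" for y
      using kernel_integrable[OF that] by (simp add: mult.commute)
  qed (auto intro: m_nonneg k_nonneg set_borel_measurable_if_integrable \<phi>_int)
  also have "\<dots> = conv (\<lambda>_. 1) \<phi> x"
    by (rule conv_cong) (auto simp: km)
  finally show ?thesis by (simp add: conv_1)
qed

text \<open>Convolution with \<open>k\<close> commutes with integration, that is, with convolution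
  by 1: associativity is used in both directions through \<open>kint\<close>, whose continuity
  supplies the integrability.\<close>

lemma conv_k_integral_forcing:
  assumes x: "x \<in> {0<..T}"
  shows "conv k (conv (\<lambda>_. 1) forcing) x = (LINT s:{0<..<x}|lborel. conv k forcing s)"
proof -
  have c1: "conv (\<lambda>_. 1) k = kint" by (simp add: conv_1 kint_def fun_eq_iff)
  then have c2: "conv k (\<lambda>_. 1) = kint" by (simp add: fun_eq_iff conv_commute[of k])
  have "continuous_on {0..x} (\<lambda>s. kint (x - s))"
    by (rule continuous_on_compose2[OF kint_continuous[of x]]) (auto intro!: continuous_intros)
  from set_integrable_mult_continuous[OF forcing_integrable[OF x] this]
  have int: "set_integrable lborel {0<..<x} (\<lambda>s. kint (x - s) * forcing s)" by (simp add: mult.commute)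
  have k_reflect: "set_integrable lborel {0<..<y} (\<lambda>t. k (y - t))" if "0 < y" for y
    using set_lborel_reflect(1)[of y k] k_int[OF that] by simp
  have "conv k (conv (\<lambda>_. 1) forcing) x = conv (conv k (\<lambda>_. 1)) forcing x"
    by (rule conv_assoc)
      (use forcing_measurable[OF x] int in \<open>auto intro: k_nonneg k_reflect simp: c2\<close>)
  also have "\<dots> = conv (conv (\<lambda>_. 1) k) forcing x" by (simp add: c1 c2)
  also have "\<dots> = conv (\<lambda>_. 1) (conv k forcing) x"
    by (rule conv_assoc[symmetric])
      (use forcing_measurable[OF x] int in \<open>auto intro: k_nonneg k_int simp: c1\<close>)
  finally show ?thesis by (simp add: conv_1)
qed

text \<open>Convolving with \<open>k\<close> gives equality of the integrals of both sides over
  every \<open>(0, y)\<close>. Both sides are continuous, for \<open>K \<phi>\<close> by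
  \<open>K_continuous\<close>, so differentiating the integrals recovers the pointwise
  equation.\<close>

lemma fixed_point_if_conv_m:
  assumes eq: "\<And>x. x \<in> {0<..T} \<Longrightarrow> conv m \<phi> x = (LINT s:{0<..<x}|lborel. forcing s)"
    and x: "x \<in> {0..T}"
  shows "\<phi> x = K \<phi> x + lam * R \<phi> x"
proof (cases "x = 0")
  case False
  define d where "d = (\<lambda>x. \<phi> x - (K \<phi> x + lam * R \<phi> x))"
  have rhs_cont: "continuous_on {0..T} (\<lambda>x. K \<phi> x + lam * R \<phi> x)"
    by (intro continuous_intros K_continuous R_continuous \<phi>)
  have "d x = 0"
  proof (rule zero_if_set_integral_zero[where h=d and T=T])
    have d: "continuous_on {0..T} d" unfolding d_def by (intro continuous_intros rhs_cont \<phi>)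
    then show "set_integrable lborel {0<..<T} d" by (rule continuous_on_imp_set_integrable_Ioo)
    show "continuous_on {0<..T} d" by (rule continuous_on_subset[OF d]) auto
    fix y assume y: "y \<in> {0<..T}"
    then have ints: "set_integrable lborel {0<..<y} \<phi>" "set_integrable lborel {0<..<y} (\<lambda>x. K \<phi> x + lam * R \<phi> x)"
      by (auto intro!: continuous_on_imp_set_integrable_Ioo intro: continuous_on_subset[OF \<phi>] continuous_on_subset[OF rhs_cont])
    have "(LINT s:{0<..<y}|lborel. \<phi> s) = conv k (conv m \<phi>) y"
      using conv_k_m_phi[OF y] by simp
    also have "\<dots> = conv k (conv (\<lambda>_. 1) forcing) y"
      by (rule conv_cong) (use y eq in \<open>auto simp: conv_1\<close>)
    also have "\<dots> = (LINT s:{0<..<y}|lborel. conv k forcing s)"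
      by (rule conv_k_integral_forcing[OF y])
    also have "\<dots> = (LINT s:{0<..<y}|lborel. K \<phi> s + lam * R \<phi> s)"
      by (rule set_lebesgue_integral_cong) (use y conv_k_forcing in auto)
    finally show "(LINT s:{0<..<y}|lborel. d s) = 0"
      unfolding d_def using set_integral_diff(2)[OF ints] by simp
  qed (use x False in auto)
  then show ?thesis by (simp add: d_def)
qed simp

lemma integral_forcing_continuous: "continuous_on {0..T} (\<lambda>x. LINT s:{0<..<x}|lborel. forcing s)"
  using conv_continuous[OF forcing_integrable[of T] continuous_on_const[of _ 1]] T_pos
  by (simp add: conv_1[abs_def])

lemma conv_m_continuous: "continuous_on {0..T} (conv m \<phi>)"
  using conv_continuous[OF m_int[OF T_pos] \<phi>] by (simp add: conv_commute[of \<phi> m, abs_def])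

text \<open>The derivatives agree on \<open>(0, T]\<close> only. The constant of integration is 0
  because both sides extend continuously to 0 and vanish there.\<close>

lemma conv_m_eq_if_derivative:
  assumes der: "\<And>x. x \<in> {0<..T} \<Longrightarrow> (conv m \<phi> has_real_derivative forcing x) (at x within {0<..T})"
    and x: "x \<in> {0<..T}"
  shows "conv m \<phi> x = (LINT s:{0<..<x}|lborel. forcing s)"
proof -
  define G where "G = (\<lambda>x. conv m \<phi> x - (LINT s:{0<..<x}|lborel. forcing s))"
  have "\<exists>c. \<forall>x\<in>{0<..T}. G x = c"
  proof (rule has_field_derivative_zero_constant)
    fix x assume x: "x \<in> {0<..T}"
    from DERIV_diff[OF der[OF x] set_integral_has_real_derivative[OF forcing_integrable forcing_continuous x]] T_pos
    show "(G has_real_derivative 0) (at x within {0<..T})" by (simp add: G_def)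
  qed simp
  then obtain c where c: "\<And>x. x \<in> {0<..T} \<Longrightarrow> G x = c" by blast
  have "continuous_on {0..T} G"
    unfolding G_def by (intro continuous_intros conv_m_continuous integral_forcing_continuous)
  then have "G 0 = c"
    using continuous_constant_on_closure[of "{0<..T}" G c 0] c T_pos by simp
  moreover have "G 0 = 0" by (simp add: G_def set_lebesgue_integral_def)
  ultimately show ?thesis using c[OF x] by (simp add: G_def)
qed

end

text \<open>Membership in \<open>C_mubar_closed\<close> comes for free from the integral equation:
  \<open>conv m \<phi>\<close> is then a primitive of \<open>forcing\<close>, which is continuous on
  \<open>(0, T]\<close>.\<close>

lemma censored_ivp_solution_iff:
  "censored_ivp_solution m T lam \<phi>0 \<phi> \<longleftrightarrow>
    continuous_on {0..T} \<phi> \<and> \<phi> 0 = \<phi>0 \<and> (\<forall>x\<in>{0..T}. \<phi> x = K \<phi> x + lam * R \<phi> x)"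
  (is "?ivp \<longleftrightarrow> ?fp")
proof
  assume ivp: ?ivp
  then have \<phi>: "continuous_on {0..T} \<phi>" and "\<phi> 0 = \<phi>0"
    by (auto simp: censored_ivp_solution_def C_mubar_closed_def)
  from ivp have "conv m \<phi> \<in> C1_upto T"
    by (auto simp: censored_ivp_solution_def C_mubar_closed_def C_mubar_open_def)
  then obtain g where g: "\<And>x. x \<in> {0<..T} \<Longrightarrow> (conv m \<phi> has_real_derivative g x) (at x within {0<..T})"
    unfolding C1_upto_def by blast
  have "(conv m \<phi> has_real_derivative forcing \<phi> lam x) (at x within {0<..T})" if x: "x \<in> {0<..T}" for x
  proof -
    have "vector_derivative (conv m \<phi>) (at x within {0<..T}) = g x"
      by (rule vector_derivative_within[OF at_within_Ioc_neq_bot[OF x]])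
        (use g[OF x] in \<open>simp add: has_real_derivative_iff_has_vector_derivative\<close>)
    moreover have "D_Ce m T \<phi> x = lam * \<phi> x" using ivp x by (auto simp: censored_ivp_solution_def)
    ultimately have "g x = forcing \<phi> lam x"
      by (simp add: D_Ce_def conv_commute[of \<phi> m, abs_def] forcing_def[OF \<phi>] algebra_simps)
    then show ?thesis using g[OF x] by simp
  qed
  from fixed_point_if_conv_m[OF \<phi> conv_m_eq_if_derivative[OF \<phi> this]] \<phi> \<open>\<phi> 0 = \<phi>0\<close>
  show ?fp by simp
next
  assume fp: ?fp
  then have \<phi>: "continuous_on {0..T} \<phi>" by simp
  have der: "(conv m \<phi> has_real_derivative forcing \<phi> lam x) (at x within {0<..T})" if x: "x \<in> {0<..T}" for x
  proof (rule has_field_derivative_transform_within[OF set_integral_has_real_derivative[OF forcing_integrable[OF \<phi>] forcing_continuous[OF \<phi>] x], of 1])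
    show "(LINT s:{0<..<y}|lborel. forcing \<phi> lam s) = conv m \<phi> y" if "y \<in> {0<..T}" for y
      using conv_m_if_fixed_point[OF \<phi> _ that, of lam] fp by simp
  qed (use x T_pos in auto)
  have "D_Ce m T \<phi> x = lam * \<phi> x" if x: "x \<in> {0<..T}" for x
  proof -
    have "vector_derivative (conv m \<phi>) (at x within {0<..T}) = forcing \<phi> lam x"
      by (rule vector_derivative_within[OF at_within_Ioc_neq_bot[OF x]])
        (use der[OF x] in \<open>simp add: has_real_derivative_iff_has_vector_derivative\<close>)
    then show ?thesis
      by (simp add: D_Ce_def conv_commute[of \<phi> m, abs_def] forcing_def[OF \<phi>] algebra_simps)
  qed
  moreover have "\<phi> \<in> C_mubar_closed m T"
    using der forcing_continuous[OF \<phi>, of lam] continuous_on_imp_set_integrable_Ioo[OF \<phi>] \<phi>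
    by (auto simp: C_mubar_closed_def C_mubar_open_def C1_upto_def intro: continuous_on_subset[OF \<phi>])
  ultimately show ?ivp using fp by (simp add: censored_ivp_solution_def)
qed

lemma censored_ivp_unique_solution:
  "censored_ivp_solution m T lam \<phi>0 (\<lambda>x. \<phi>0 * solution lam x)"
  "censored_ivp_solution m T lam \<phi>0 \<psi> \<Longrightarrow> x \<in> {0..T} \<Longrightarrow> \<psi> x = \<phi>0 * solution lam x"
proof -
  let ?s = "\<lambda>x. \<phi>0 * solution lam x"
  have s: "continuous_on {0..T} ?s" by (intro continuous_intros solution_continuous)
  have s_fp: "?s x = K ?s x + lam * R ?s x" if "x \<in> {0..T}" for x
    by (subst solution_fixed_point[OF that]) (simp add: K_scale R_scale algebra_simps)
  show "censored_ivp_solution m T lam \<phi>0 ?s"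
    unfolding censored_ivp_solution_iff using s s_fp by (simp add: solution_at_0)
  assume \<psi>: "censored_ivp_solution m T lam \<phi>0 \<psi>" and x: "x \<in> {0..T}"
  then have \<psi>_cont: "continuous_on {0..T} \<psi>" and "\<psi> 0 = \<phi>0"
    and \<psi>_fp: "\<And>x. x \<in> {0..T} \<Longrightarrow> \<psi> x = K \<psi> x + lam * R \<psi> x"
    by (auto simp: censored_ivp_solution_iff)
  have s': "continuous_on {0..T} (\<lambda>x. (- 1) * ?s x)" by (intro continuous_intros s)
  have "\<psi> x + (- 1) * ?s x = 0"
  proof (rule integral_equation_unique[OF _ _ _ x])
    show "continuous_on {0..T} (\<lambda>x. \<psi> x + (- 1) * ?s x)" by (intro continuous_intros s' \<psi>_cont)
    show "\<psi> 0 + (- 1) * ?s 0 = 0" using \<open>\<psi> 0 = \<phi>0\<close> by (simp add: solution_at_0)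
    show "\<psi> y + (- 1) * ?s y = K (\<lambda>x. \<psi> x + (- 1) * ?s x) y + lam * R (\<lambda>x. \<psi> x + (- 1) * ?s x) y"
      if y: "y \<in> {0..T}" for y
      unfolding K_add[OF \<psi>_cont s' y] R_add[OF \<psi>_cont s' y] K_scale[of "- 1" ?s] R_scale[of "- 1" ?s]
      using \<psi>_fp[OF y] s_fp[OF y] by (simp add: algebra_simps)
  qed
  then show "\<psi> x = ?s x" by simp
qed

end

section \<open>Laplace transforms and the Sonine identity\<close>

lemma laplace_exp:
  assumes s: "0 < (s::real)"
  shows "(\<integral>\<^sup>+x. ennreal (indicator {0<..} x * exp (- (s * x))) \<partial>lborel) = ennreal (1 / s)"
proof -
  have "(\<integral>\<^sup>+x. ennreal (indicator {0<..} x * exp (- (s * x))) \<partial>lborel)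
      = (\<integral>\<^sup>+x. ennreal (exp (- (s * x))) * indicator {0..} x \<partial>lborel)"
    using AE_lborel_singleton[of 0] by (intro nn_integral_cong_AE) (auto elim!: eventually_mono simp: indicator_def)
  also have "\<dots> = ennreal (0 - - (exp (- (s * 0)) / s))"
  proof (rule nn_integral_FTC_atLeast)
    have "((\<lambda>x. exp (- (s * x))) \<longlongrightarrow> 0) at_top"
      by (rule filterlim_compose[OF exp_at_bot]) (use s in \<open>simp add: filterlim_uminus_at_top[symmetric] filterlim_tendsto_pos_mult_at_top[OF tendsto_const _ filterlim_ident]\<close>)
    then have "((\<lambda>x. - (exp (- (s * x)) / s)) \<longlongrightarrow> - (0 / s)) at_top"
      using s by (intro tendsto_intros) auto
    then show "((\<lambda>x. - (exp (- (s * x)) / s)) \<longlongrightarrow> 0) at_top" by simp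
  qed (use s in \<open>auto intro!: derivative_eq_intros\<close>)
  finally show ?thesis by simp
qed

text \<open>In the variable \<open>u = exp (- x)\<close> the hypothesis says that all moments of a finite signed
  measure on \<open>[0, 1]\<close> vanish, so Weierstrass approximation applies.\<close>
lemma laplace_unique_0:
  fixes h :: "real \<Rightarrow> real"
  assumes int: "integrable lborel (\<lambda>x. indicator {0<..} x * (exp (- (s * x)) * h x))"
    and zero: "\<And>n::nat. (LINT x|lborel. indicator {0<..} x * (exp (- ((s + n) * x)) * h x)) = 0"
    and cont: "\<And>x. 0 < x \<Longrightarrow> isCont h x" and x0: "0 < x0"
  shows "h x0 = 0"
proof (rule ccontr)
  assume nz: "h x0 \<noteq> 0"
  define P where "P = (\<lambda>x. indicator {0<..} x * (exp (- (s * x)) * h x))"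
  have P: "integrable lborel P" using int by (simp add: P_def)
  then have [measurable]: "P \<in> borel_measurable borel" by auto
  have bounded_int: "integrable lborel (\<lambda>x. g (exp (- x)) * P x)"
    if g: "continuous_on UNIV g" for g :: "real \<Rightarrow> real"
  proof -
    have [measurable]: "g \<in> borel_measurable borel" using g by (rule borel_measurable_continuous_onI)
    have "continuous_on {0..1} g" using g by (rule continuous_on_subset) auto
    then obtain B where B: "0 \<le> B" "\<And>x. 0 \<le> x \<Longrightarrow> x \<le> 1 \<Longrightarrow> \<bar>g x\<bar> \<le> B"
      using continuous_on_Icc_bounded by blast
    show ?thesis
    proof (rule Bochner_Integration.integrable_bound)
      show "integrable lborel (\<lambda>x. B * P x)" using P by auto
      show "AE x in lborel. norm (g (exp (- x)) * P x) \<le> norm (B * P x)"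
      proof (intro AE_I2)
        fix x show "norm (g (exp (- x)) * P x) \<le> norm (B * P x)"
          using B by (cases "0 < x") (auto simp: P_def abs_mult intro!: mult_right_mono)
      qed
    qed measurable
  qed
  have power: "(LINT x|lborel. exp (- x) ^ n * P x) = 0" for n
  proof -
    have "exp (- x) ^ n * P x = indicator {0<..} x * (exp (- ((s + n) * x)) * h x)" for x
      by (simp add: P_def exp_add[symmetric] exp_of_nat_mult[symmetric] algebra_simps)
    then show ?thesis using zero[of n] by simp
  qed
  have poly: "(LINT x|lborel. p (exp (- x)) * P x) = 0" if "real_polynomial_function p" for p
  proof -
    obtain a n where p: "p = (\<lambda>x. \<Sum>i\<le>n. a i * x ^ i)"
      using \<open>real_polynomial_function p\<close> by (auto simp: real_polynomial_function_iff_sum)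
    have pint: "integrable lborel (\<lambda>x. exp (- x) ^ i * P x)" for i
      by (rule bounded_int[of "\<lambda>x. x ^ i"]) (intro continuous_intros)
    have "(LINT x|lborel. p (exp (- x)) * P x) = (LINT x|lborel. (\<Sum>i\<le>n. a i * (exp (- x) ^ i * P x)))"
      by (simp add: p sum_distrib_right mult.assoc)
    also have "\<dots> = (\<Sum>i\<le>n. a i * (LINT x|lborel. exp (- x) ^ i * P x))"
      using pint by (subst Bochner_Integration.integral_sum) auto
    finally show ?thesis by (simp add: power)
  qed
  have test: "(LINT x|lborel. g (exp (- x)) * P x) = 0" if g: "continuous_on UNIV g" for g :: "real \<Rightarrow> real"
  proof -
    define M where "M = (LINT x|lborel. \<bar>P x\<bar>)"
    have M: "0 \<le> M" by (simp add: M_def)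
    have "\<bar>LINT x|lborel. g (exp (- x)) * P x\<bar> \<le> e * M" if "0 < e" for e
    proof -
      have "continuous_on {0..1} g" using g by (rule continuous_on_subset) auto
      then obtain p where p: "real_polynomial_function p" "\<And>x. x \<in> {0..1} \<Longrightarrow> \<bar>g x - p x\<bar> < e"
        using Stone_Weierstrass_real_polynomial_function[of "{0..1}" g e] \<open>0 < e\<close> by auto
      have "continuous_on UNIV p"
        using p(1) continuous_on_polymonial_function[of p UNIV] by (simp add: real_polynomial_function_eq)
      then have int': "integrable lborel (\<lambda>x. p (exp (- x)) * P x)" by (rule bounded_int)
      have "(LINT x|lborel. g (exp (- x)) * P x) = (LINT x|lborel. g (exp (- x)) * P x - p (exp (- x)) * P x)"
        using poly[OF p(1)] bounded_int[OF g] int' by simp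
      also have "\<bar>\<dots>\<bar> \<le> (LINT x|lborel. e * \<bar>P x\<bar>)"
      proof (rule integral_abs_bound_integral)
        fix x
        show "\<bar>g (exp (- x)) * P x - p (exp (- x)) * P x\<bar> \<le> e * \<bar>P x\<bar>"
        proof (cases "0 < x")
          case True
          then have "\<bar>g (exp (- x)) - p (exp (- x))\<bar> \<le> e" using p(2)[of "exp (- x)"] by auto
          from mult_right_mono[OF this abs_ge_zero[of "P x"]]
          show ?thesis by (simp add: abs_mult[symmetric] left_diff_distrib)
        qed (simp add: P_def)
      qed (use P bounded_int[OF g] int' in auto)
      finally show ?thesis by (simp add: M_def)
    qed
    note approx = this
    \<comment> \<open>\<open>M\<close> may be 0, hence the division by \<open>M + 1\<close>.\<close>
    have "\<bar>LINT x|lborel. g (exp (- x)) * P x\<bar> \<le> e" if e: "0 < e" for e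
    proof -
      have "\<bar>LINT x|lborel. g (exp (- x)) * P x\<bar> \<le> e / (M + 1) * M"
        by (rule approx) (use M e in auto)
      also have "\<dots> \<le> e / (M + 1) * (M + 1)" using M e by (intro mult_left_mono) auto
      finally show ?thesis using M by simp
    qed
    then show ?thesis using field_le_epsilon[of "\<bar>LINT x|lborel. g (exp (- x)) * P x\<bar>" 0] by auto
  qed
  \<comment> \<open>The factor \<open>h x0\<close> treats both signs of \<open>h x0\<close> at
    once.\<close>
  have "isCont (\<lambda>x. h x0 * h x) x0" using cont[OF x0] by (intro continuous_intros)
  moreover have "0 < h x0 * h x0" using nz not_square_less_zero[of "h x0"] by (simp add: less_le)
  ultimately have "\<forall>\<^sub>F x in at x0. 0 < h x0 * h x"
    by (intro order_tendstoD) (auto simp: isCont_def)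
  then obtain d where d: "0 < d" "\<And>x. x \<noteq> x0 \<Longrightarrow> \<bar>x - x0\<bar> < d \<Longrightarrow> 0 < h x0 * h x"
    by (auto simp: eventually_at dist_real_def)
  \<comment> \<open>The bound by \<open>x0\<close> keeps the interval inside the half-line, where
    \<open>P\<close> is not cut off.\<close>
  define e where "e = min d x0"
  have e: "0 < e" "e \<le> x0" using d(1) x0 by (auto simp: e_def)
  have pos: "0 < h x0 * h x" if "x0 - e < x" "x < x0 + e" for x
    using d(2)[of x] \<open>0 < h x0 * h x0\<close> that by (cases "x = x0") (auto simp: e_def)
  \<comment> \<open>A truncated parabola in \<open>u = exp (- x)\<close>, positive exactly for
    \<open>x0 - e < x < x0 + e\<close>.\<close>
  define g where "g = (\<lambda>u. max 0 ((u - exp (- (x0 + e))) * (exp (- (x0 - e)) - u)))"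
  have g_pos: "0 < g (exp (- x))" if "x0 - e < x" "x < x0 + e" for x
    using that by (auto simp: g_def less_max_iff_disj intro!: mult_pos_pos)
  have g_zero: "g (exp (- x)) = 0" if "\<not> (x0 - e < x \<and> x < x0 + e)" for x
  proof -
    have "(exp (- x) - exp (- (x0 + e))) * (exp (- (x0 - e)) - exp (- x)) \<le> 0"
      using that e(1) by (cases "x \<le> x0 - e") (auto intro: mult_nonneg_nonpos mult_nonpos_nonneg)
    then show ?thesis by (simp add: g_def)
  qed
  define G where "G = (\<lambda>x. h x0 * (g (exp (- x)) * P x))"
  have g_cont: "continuous_on UNIV g" unfolding g_def by (intro continuous_intros)
  have G_pos: "0 < G x" if "x0 - e < x" "x < x0 + e" for x
  proof -
    have "G x = g (exp (- x)) * exp (- (s * x)) * (h x0 * h x)"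
      using that e by (simp add: G_def P_def)
    then show ?thesis using g_pos[OF that] pos[OF that] by simp
  qed
  have G_nonneg: "0 \<le> G x" for x
    using G_pos[of x] g_zero[of x] by (cases "x0 - e < x \<and> x < x0 + e") (auto simp: G_def)
  have "integrable lborel G" unfolding G_def using bounded_int[OF g_cont] by (rule integrable_mult_right)
  moreover have "(LINT x|lborel. G x) = 0" unfolding G_def using test[OF g_cont] by simp
  ultimately have "AE x in lborel. G x = 0"
    using integral_nonneg_eq_0_iff_AE[of lborel G] G_nonneg by simp
  then have "AE x in lborel. x \<notin> {x0 - e<..<x0 + e}"
    using G_pos by (auto elim!: eventually_mono simp: less_le)
  then have "emeasure lborel {x0 - e<..<x0 + e} = 0"
    by (subst (asm) AE_iff_null_sets[symmetric]) auto
  then show False using e(1) by simp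
qed

text \<open>By Tonelli the transform of \<open>conv m k\<close> is the product of the two
  transforms, \<open>1 / s\<close>, which is also that of the constant 1. Continuity of
  \<open>conv m k\<close> turns uniqueness into equality at every point. Only
  \<open>s \<ge> r\<close> matters, as \<open>laplace_unique_0\<close> uses the values at
  \<open>r + n\<close>.\<close>

lemma sonine_if_laplace:
  fixes m k :: "real \<Rightarrow> real"
  assumes [measurable]: "m \<in> borel_measurable borel" "k \<in> borel_measurable borel"
    and m0: "\<And>t. 0 < t \<Longrightarrow> 0 \<le> m t" and k0: "\<And>t. 0 < t \<Longrightarrow> 0 \<le> k t"
    and m_anti: "\<And>s t. 0 < s \<Longrightarrow> s \<le> t \<Longrightarrow> m t \<le> m s"
    and k_anti: "\<And>s t. 0 < s \<Longrightarrow> s \<le> t \<Longrightarrow> k t \<le> k s"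
    and m_int: "\<And>x. 0 < x \<Longrightarrow> set_integrable lborel {0<..<x} m"
    and k_int: "\<And>x. 0 < x \<Longrightarrow> set_integrable lborel {0<..<x} k"
    and m_cont: "continuous_on {0<..} m" and r: "0 < r"
    and lap: "\<And>s. r \<le> s \<Longrightarrow>
      (\<integral>\<^sup>+x. ennreal (indicator {0<..} x * (exp (- (s * x)) * m x)) \<partial>lborel) *
      (\<integral>\<^sup>+x. ennreal (indicator {0<..} x * (exp (- (s * x)) * k x)) \<partial>lborel) = ennreal (1 / s)"
    and x: "0 < x"
  shows "conv m k x = 1"
proof -
  have mk_int: "set_integrable lborel {0<..<x} (\<lambda>t. m (x - t) * k t)" if "0 < x" for x
    using set_lborel_reflect(1)[of x "\<lambda>t. m t * k (x - t)"]
      antimono_kernel_integrable[OF assms(1,2) m0 k0 m_anti k_anti m_int k_int that] by simp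
  have conv_if: "conv m k x = (LINT t|lborel. (if 0 < t \<and> t < x then m (x - t) * k t else 0))" for x
    unfolding conv_def set_lebesgue_integral_def by (intro Bochner_Integration.integral_cong) auto
  have [measurable]: "conv m k \<in> borel_measurable borel"
    unfolding conv_if[abs_def] by measurable
  have conv0: "0 \<le> conv m k x" for x by (rule conv_nonneg) (auto simp: m0 k0)
  have conv_lap: "(\<integral>\<^sup>+x. ennreal (indicator {0<..} x * (exp (- (s * x)) * conv m k x)) \<partial>lborel) = ennreal (1 / s)"
    if s: "r \<le> s" for s
  proof -
    define Q where "Q = (\<lambda>x t. ennreal (if 0 < t \<and> t < x then (exp (- (s * (x - t))) * m (x - t)) * (exp (- (s * t)) * k t) else 0))"
    have [measurable]: "(\<lambda>(x, t). Q x t) \<in> borel_measurable (lborel \<Otimes>\<^sub>M lborel)"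
      unfolding Q_def by measurable
    have "ennreal (indicator {0<..} x * (exp (- (s * x)) * conv m k x)) = (\<integral>\<^sup>+t. Q x t \<partial>lborel)" for x
    proof (cases "0 < x")
      case True
      have "Q x t = ennreal (exp (- (s * x)) * (indicator {0<..<x} t *\<^sub>R (m (x - t) * k t)))" for t
        by (auto simp: Q_def indicator_def exp_minus exp_diff right_diff_distrib field_simps)
      moreover have "(\<integral>\<^sup>+t. ennreal (exp (- (s * x)) * (indicator {0<..<x} t *\<^sub>R (m (x - t) * k t))) \<partial>lborel)
          = ennreal (LINT t|lborel. exp (- (s * x)) * (indicator {0<..<x} t *\<^sub>R (m (x - t) * k t)))"
        using mk_int[OF True] m0 k0
        by (intro nn_integral_eq_integral AE_I2) (auto simp: set_integrable_def indicator_def)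
      ultimately show ?thesis using True by (simp add: conv_def set_lebesgue_integral_def)
    next
      case False
      then have "Q x t = 0" for t by (auto simp: Q_def)
      then show ?thesis using False by simp
    qed
    then have "(\<integral>\<^sup>+x. ennreal (indicator {0<..} x * (exp (- (s * x)) * conv m k x)) \<partial>lborel) = (\<integral>\<^sup>+x. \<integral>\<^sup>+t. Q x t \<partial>lborel \<partial>lborel)"
      by simp
    also have "\<dots> = (\<integral>\<^sup>+t. \<integral>\<^sup>+x. Q x t \<partial>lborel \<partial>lborel)"
      using lborel_pair.Fubini[of "\<lambda>(x, t). Q x t"] by simp
    also have "\<dots> = (\<integral>\<^sup>+t. (\<integral>\<^sup>+x. ennreal (indicator {0<..} x * (exp (- (s * x)) * m x)) \<partial>lborel) *
        ennreal (indicator {0<..} t * (exp (- (s * t)) * k t)) \<partial>lborel)"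
    proof (rule nn_integral_cong)
      fix t
      have "(\<integral>\<^sup>+x. Q x t \<partial>lborel) = (\<integral>\<^sup>+x. ennreal (indicator {0<..} (x - t) * (exp (- (s * (x - t))) * m (x - t))) *
          ennreal (indicator {0<..} t * (exp (- (s * t)) * k t)) \<partial>lborel)"
        using m0 k0 by (intro nn_integral_cong) (auto simp: Q_def indicator_def ennreal_mult[symmetric])
      also have "\<dots> = (\<integral>\<^sup>+x. ennreal (indicator {0<..} (x - t) * (exp (- (s * (x - t))) * m (x - t))) \<partial>lborel) *
          ennreal (indicator {0<..} t * (exp (- (s * t)) * k t))"
        by (rule nn_integral_multc) measurable
      also have "(\<integral>\<^sup>+x. ennreal (indicator {0<..} (x - t) * (exp (- (s * (x - t))) * m (x - t))) \<partial>lborel) =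
          (\<integral>\<^sup>+x. ennreal (indicator {0<..} x * (exp (- (s * x)) * m x)) \<partial>lborel)"
        using nn_integral_real_affine[of "\<lambda>x. ennreal (indicator {0<..} (x - t) * (exp (- (s * (x - t))) * m (x - t)))" 1 t]
        by simp
      finally show "(\<integral>\<^sup>+x. Q x t \<partial>lborel) = (\<integral>\<^sup>+x. ennreal (indicator {0<..} x * (exp (- (s * x)) * m x)) \<partial>lborel) *
        ennreal (indicator {0<..} t * (exp (- (s * t)) * k t))" .
    qed
    also have "\<dots> = ennreal (1 / s)"
      by (subst nn_integral_cmult) (auto simp: lap[OF s])
    finally show ?thesis .
  qed
  have both: "has_bochner_integral lborel (\<lambda>x. indicator {0<..} x * (exp (- (s * x)) * (conv m k x - 1))) 0"
    if s: "r \<le> s" for s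
  proof -
    have "0 < s" using s r by simp
    have "has_bochner_integral lborel (\<lambda>x. indicator {0<..} x * (exp (- (s * x)) * conv m k x)) (1 / s)"
      by (rule has_bochner_integral_nn_integral) (use conv_lap[OF s] conv0 \<open>0 < s\<close> in auto)
    moreover have "has_bochner_integral lborel (\<lambda>x. indicator {0<..} x * exp (- (s * x))) (1 / s)"
      by (rule has_bochner_integral_nn_integral) (use laplace_exp \<open>0 < s\<close> in auto)
    ultimately have "has_bochner_integral lborel (\<lambda>x. indicator {0<..} x * (exp (- (s * x)) * conv m k x) -
        indicator {0<..} x * exp (- (s * x))) (1 / s - 1 / s)"
      by (rule has_bochner_integral_diff)
    then show ?thesis by (simp add: right_diff_distrib)
  qed
  have "conv m k x - 1 = 0"
  proof (rule laplace_unique_0[where s=r and h="\<lambda>x. conv m k x - 1"])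
    show "integrable lborel (\<lambda>x. indicator {0<..} x * (exp (- (r * x)) * (conv m k x - 1)))"
      using both[of r] by (auto simp: has_bochner_integral_iff)
    show "(LINT x|lborel. indicator {0<..} x * (exp (- ((r + real n) * x)) * (conv m k x - 1))) = 0" for n
      using both[of "r + real n"] by (auto simp: has_bochner_integral_iff)
    fix y :: real assume y: "0 < y"
    have "continuous_on {0<..y + 1} (\<lambda>x. LINT t:{0<..<x}|lborel. m t * k (x - t) * 1)"
      by (rule antimono_kernel_continuous[OF assms(1,2) m0 k0 m_anti k_anti m_int k_int m_cont, where B=1]) auto
    moreover have "(LINT t:{0<..<x}|lborel. m t * k (x - t) * 1) = conv m k x" for x
      using conv_commute[of k m x] by (simp add: conv_def mult.commute)
    ultimately have "continuous_on {0<..<y + 1} (conv m k)"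
      by (auto elim: continuous_on_subset)
    then have "isCont (conv m k) y" using y by (simp add: continuous_on_eq_continuous_at)
    then show "isCont (\<lambda>x. conv m k x - 1) y" by (intro continuous_intros)
  qed (rule x)
  then show ?thesis by simp
qed

section \<open>Tails of Levy measures\<close>

context
  fixes \<mu> :: "real measure"
  assumes \<mu>: "levy_measure \<mu>"
begin

lemma levy_sets [measurable_cong, simp]: "sets \<mu> = sets borel"
  using \<mu> by (simp add: levy_measure_def)

lemma levy_space [simp]: "space \<mu> = UNIV"
  using sets_eq_imp_space_eq[OF levy_sets] by simp

lemma levy_tail_finite:
  assumes x: "0 < x"
  shows "emeasure \<mu> {x<..} < \<infinity>"
proof -
  have "ennreal (min 1 x) * emeasure \<mu> {x<..} = (\<integral>\<^sup>+t. ennreal (min 1 x) * indicator {x<..} t \<partial>\<mu>)"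
    by (simp add: nn_integral_cmult_indicator)
  also have "\<dots> \<le> (\<integral>\<^sup>+t. ennreal (min 1 t) \<partial>\<mu>)"
    by (intro nn_integral_mono) (auto simp: indicator_def intro!: ennreal_leI)
  also have "\<dots> < \<infinity>" using \<mu> by (simp add: levy_measure_def)
  finally show ?thesis using x by (auto simp: ennreal_mult_less_top)
qed

text \<open>The mass near 0 may be infinite, so the half-line is exhausted by tails of finite mass.
  Needed for Tonelli with \<open>lborel\<close>.\<close>

lemma levy_sigma_finite: "sigma_finite_measure \<mu>"
proof
  let ?A = "insert {..0} (range (\<lambda>n. {1 / real (Suc n)<..}))"
  have "t \<in> \<Union> ?A" for t
  proof (cases "t \<le> 0")
    case False
    then obtain n where "1 / real (Suc n) < t"
      using reals_Archimedean[of t] by (auto simp: inverse_eq_divide)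
    then have "t \<in> {1 / real (Suc n)<..}" by simp
    then show ?thesis by blast
  qed simp
  then have "\<Union> ?A = space \<mu>" by auto
  moreover have "emeasure \<mu> {..0} = 0" using \<mu> by (simp add: levy_measure_def)
  ultimately show "\<exists>A. countable A \<and> A \<subseteq> sets \<mu> \<and> \<Union> A = space \<mu> \<and> (\<forall>a\<in>A. emeasure \<mu> a \<noteq> \<infinity>)"
    using levy_tail_finite by (intro exI[of _ ?A]) (auto simp: less_top)
qed

lemma tail_nonneg: "0 \<le> tail \<mu> x"
  by (simp add: tail_def)

lemma emeasure_tail: "0 < x \<Longrightarrow> emeasure \<mu> {x<..} = ennreal (tail \<mu> x)"
  using levy_tail_finite[of x] by (simp add: tail_def emeasure_eq_ennreal_measure)

lemma tail_antimono: "0 < x \<Longrightarrow> x \<le> y \<Longrightarrow> tail \<mu> y \<le> tail \<mu> x"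
  using emeasure_mono[of "{y<..}" "{x<..}" \<mu>] emeasure_tail[of x] emeasure_tail[of y] tail_nonneg[of x]
  by (simp add: ennreal_le_iff)

lemma tail_measurable: "tail \<mu> \<in> borel_measurable borel"
proof -
  interpret sigma_finite_measure \<mu> by (rule levy_sigma_finite)
  have "{p \<in> space (borel \<Otimes>\<^sub>M \<mu>). fst p < snd p} \<in> sets (borel \<Otimes>\<^sub>M \<mu>)" by measurable
  from measurable_emeasure_Pair[OF this]
  have "(\<lambda>x. emeasure \<mu> {x<..}) \<in> borel_measurable borel"
    by (simp add: vimage_def greaterThan_def space_pair_measure)
  then show ?thesis unfolding tail_def[abs_def] measure_def by measurable
qed

lemma levy_integrable:
  assumes s: "0 < s"
  shows "set_integrable \<mu> {0<..} (\<lambda>t. 1 - exp (- s * t))"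
proof -
  have "integrable \<mu> (\<lambda>t. indicator {0<..} t * min 1 t)"
  proof (rule integrableI_nonneg)
    have "(\<integral>\<^sup>+t. ennreal (indicator {0<..} t * min 1 t) \<partial>\<mu>) \<le> (\<integral>\<^sup>+t. ennreal (min 1 t) \<partial>\<mu>)"
      by (intro nn_integral_mono) (auto simp: indicator_def)
    then show "(\<integral>\<^sup>+t. ennreal (indicator {0<..} t * min 1 t) \<partial>\<mu>) < \<infinity>"
      using \<mu> by (auto simp: levy_measure_def)
  qed (auto simp: indicator_def)
  then have "integrable \<mu> (\<lambda>t. max 1 s * (indicator {0<..} t * min 1 t))" by simp
  then show ?thesis
    unfolding set_integrable_def
  proof (rule Bochner_Integration.integrable_bound)
    show "AE t in \<mu>. norm (indicator {0<..} t *\<^sub>R (1 - exp (- s * t))) \<le> norm (max 1 s * (indicator {0<..} t * min 1 t))"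
    proof (intro AE_I2)
      fix t :: real
      have "1 - exp (- s * t) \<le> max 1 s * min 1 t" if "0 < t"
      proof (cases "t \<le> 1")
        case True
        have "1 - exp (- s * t) \<le> s * t" using exp_ge_add_one_self[of "- s * t"] by simp
        also have "\<dots> \<le> max 1 s * t" using that by (intro mult_right_mono) auto
        finally show ?thesis using True by simp
      next
        case False
        then have "max 1 s * min 1 t = max 1 s" by simp
        then show ?thesis using exp_ge_zero[of "- s * t"] by (auto simp: le_max_iff_disj simp del: exp_ge_zero)
      qed
      then show "norm (indicator {0<..} t *\<^sub>R (1 - exp (- s * t))) \<le> norm (max 1 s * (indicator {0<..} t * min 1 t))"
        using s by (auto simp: indicator_def abs_mult)
    qed
  qed measurable
qed

text \<open>Tonelli on \<open>0 < x < t\<close>: the integral of \<open>exp (- (s * x))\<close> over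
  \<open>(0, t)\<close> is \<open>(1 - exp (- s * t)) / s\<close>.\<close>

lemma laplace_tail:
  assumes s: "0 < s"
  shows "(\<integral>\<^sup>+x. ennreal (indicator {0<..} x * (exp (- (s * x)) * tail \<mu> x)) \<partial>lborel)
    = ennreal ((LINT t:{0<..}|\<mu>. 1 - exp (- s * t)) / s)"
proof -
  interpret sigma_finite_measure \<mu> by (rule levy_sigma_finite)
  interpret pair_sigma_finite lborel \<mu> ..
  define Q where "Q = (\<lambda>x t. ennreal (exp (- (s * x))) * indicator {p. 0 < fst p \<and> fst p < snd p} (x, t))"
  have "{p \<in> space (lborel \<Otimes>\<^sub>M \<mu>). 0 < fst p \<and> fst p < snd p} \<in> sets (lborel \<Otimes>\<^sub>M \<mu>)" by measurable
  then have [measurable]: "{p. 0 < fst p \<and> fst p < snd p} \<in> sets (lborel \<Otimes>\<^sub>M \<mu>)"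
    by (simp add: space_pair_measure)
  have [measurable]: "(\<lambda>(x, t). Q x t) \<in> borel_measurable (lborel \<Otimes>\<^sub>M \<mu>)"
    unfolding Q_def by measurable
  have "ennreal (indicator {0<..} x * (exp (- (s * x)) * tail \<mu> x)) = (\<integral>\<^sup>+t. Q x t \<partial>\<mu>)" for x
  proof (cases "0 < x")
    case True
    have "Q x t = ennreal (exp (- (s * x))) * indicator {x<..} t" for t
      using True by (auto simp: Q_def indicator_def)
    then have "(\<integral>\<^sup>+t. Q x t \<partial>\<mu>) = ennreal (exp (- (s * x))) * emeasure \<mu> {x<..}"
      by (simp add: nn_integral_cmult_indicator)
    then show ?thesis using True by (simp add: emeasure_tail ennreal_mult[symmetric] tail_nonneg)
  next
    case False
    then have "Q x t = 0" for t by (simp add: Q_def)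
    then show ?thesis using False by simp
  qed
  then have "(\<integral>\<^sup>+x. ennreal (indicator {0<..} x * (exp (- (s * x)) * tail \<mu> x)) \<partial>lborel) = (\<integral>\<^sup>+x. \<integral>\<^sup>+t. Q x t \<partial>\<mu> \<partial>lborel)"
    by simp
  also have "\<dots> = (\<integral>\<^sup>+t. \<integral>\<^sup>+x. Q x t \<partial>lborel \<partial>\<mu>)"
    using Fubini[of "\<lambda>(x, t). Q x t"] by simp
  also have "\<dots> = (\<integral>\<^sup>+t. ennreal (indicator {0<..} t *\<^sub>R (1 - exp (- s * t)) / s) \<partial>\<mu>)"
  proof (rule nn_integral_cong)
    fix t
    show "(\<integral>\<^sup>+x. Q x t \<partial>lborel) = ennreal (indicator {0<..} t *\<^sub>R (1 - exp (- s * t)) / s)"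
    proof (cases "0 < t")
      case True
      have "(\<integral>\<^sup>+x. Q x t \<partial>lborel) = (\<integral>\<^sup>+x. ennreal (exp (- (s * x))) * indicator {0..t} x \<partial>lborel)"
      proof (rule nn_integral_cong_AE)
        show "AE x in lborel. Q x t = ennreal (exp (- (s * x))) * indicator {0..t} x"
          using AE_lborel_singleton[of 0] AE_lborel_singleton[of t]
          by eventually_elim (auto simp: Q_def indicator_def)
      qed
      also have "\<dots> = ennreal (- (exp (- (s * t)) / s) - - (exp (- (s * 0)) / s))"
        by (rule nn_integral_FTC_Icc) (use s True in \<open>auto intro!: derivative_eq_intros\<close>)
      finally show ?thesis using True by (simp add: diff_divide_distrib)
    next
      case False
      then have "Q x t = 0" for x by (auto simp: Q_def)
      then show ?thesis using False by simp
    qed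
  qed
  also have "\<dots> = ennreal (LINT t|\<mu>. indicator {0<..} t *\<^sub>R (1 - exp (- s * t)) / s)"
  proof (rule nn_integral_eq_integral)
    show "integrable \<mu> (\<lambda>t. indicator {0<..} t *\<^sub>R (1 - exp (- s * t)) / s)"
      using levy_integrable[OF s] by (simp add: set_integrable_def)
  qed (use s in \<open>auto simp: indicator_def\<close>)
  finally show ?thesis by (simp add: set_lebesgue_integral_def)
qed

text \<open>The transform at \<open>s = 1\<close> is finite, and on \<open>(0, x)\<close> its
  damping factor is at least \<open>exp (- x)\<close>.\<close>

lemma tail_integrable:
  assumes x: "0 < x"
  shows "set_integrable lborel {0<..<x} (tail \<mu>)"
proof -
  note [measurable] = tail_measurable
  have "integrable lborel (\<lambda>t. indicator {0<..} t * (exp (- (1 * t)) * tail \<mu> t))"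
    by (rule integrableI_nonneg) (use laplace_tail[of 1] in \<open>auto simp: tail_nonneg indicator_def\<close>)
  then have "integrable lborel (\<lambda>t. exp x * (indicator {0<..} t * (exp (- (1 * t)) * tail \<mu> t)))" by simp
  then show ?thesis
    unfolding set_integrable_def
  proof (rule Bochner_Integration.integrable_bound)
    show "AE t in lborel. norm (indicator {0<..<x} t *\<^sub>R tail \<mu> t) \<le> norm (exp x * (indicator {0<..} t * (exp (- (1 * t)) * tail \<mu> t)))"
    proof (intro AE_I2)
      fix t :: real
      have "1 * tail \<mu> t \<le> exp (x - t) * tail \<mu> t" if "t < x"
        using that by (intro mult_right_mono tail_nonneg) auto
      then show "norm (indicator {0<..<x} t *\<^sub>R tail \<mu> t) \<le> norm (exp x * (indicator {0<..} t * (exp (- (1 * t)) * tail \<mu> t)))"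
        by (auto simp: indicator_def abs_mult tail_nonneg exp_diff exp_minus divide_inverse mult.assoc)
    qed
  qed measurable
qed

lemma tail_small:
  assumes e: "0 < e"
  shows "\<exists>x>0. tail \<mu> x < e"
proof -
  have "(\<lambda>n. measure \<mu> {real (Suc n)<..}) \<longlonglongrightarrow> measure \<mu> (\<Inter>n. {real (Suc n)<..})"
    by (rule Lim_measure_decseq) (use levy_tail_finite in \<open>auto simp: decseq_def less_top\<close>)
  moreover have "(\<Inter>n. {real (Suc n)<..}) = {}"
  proof -
    have "t \<notin> (\<Inter>n. {real (Suc n)<..})" for t
    proof -
      obtain n where "t < real n" using reals_Archimedean2[of t] by blast
      then have "t \<notin> {real (Suc n)<..}" by simp
      then show ?thesis by blast
    qed
    then show ?thesis by blast
  qed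
  ultimately have "(\<lambda>n. tail \<mu> (real (Suc n))) \<longlonglongrightarrow> 0" by (simp add: tail_def)
  from order_tendstoD(2)[OF this e] obtain n where "tail \<mu> (real (Suc n)) < e"
    by (auto simp: eventually_sequentially)
  then show ?thesis by (intro exI[of _ "real (Suc n)"]) auto
qed

text \<open>The indicators of \<open>{X n<..}\<close> converge except at \<open>t = x\<close>, which
  carries no mass, and that of \<open>{a/2<..}\<close>, a set of finite measure, dominates
  them.\<close>

lemma tail_continuous:
  assumes no_atom: "\<And>x. emeasure \<mu> {x} = 0"
  shows "continuous_on {0<..} (tail \<mu>)"
proof -
  have "continuous_on {a..} (tail \<mu>)" if a: "0 < a" for a
    unfolding continuous_on_sequentially comp_def
  proof (intro allI ballI impI, elim conjE)
    fix X :: "nat \<Rightarrow> real" and x assume Xa: "\<forall>n. X n \<in> {a..}" and X: "X \<longlonglongrightarrow> x"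
    have "(\<lambda>n. LINT t|\<mu>. indicator {X n<..} t :: real) \<longlonglongrightarrow> (LINT t|\<mu>. indicator {x<..} t)"
    proof (rule integral_dominated_convergence[where w="indicator {a/2<..}"])
      show "integrable \<mu> (indicator {a/2<..} :: real \<Rightarrow> real)"
        using levy_tail_finite[of "a/2"] a by (intro integrable_real_indicator) auto
      have "AE t in \<mu>. t \<noteq> x"
        using no_atom[of x] by (intro AE_I[of _ _ "{x}"]) auto
      then show "AE t in \<mu>. (\<lambda>n. indicator {X n<..} t :: real) \<longlonglongrightarrow> indicator {x<..} t"
      proof eventually_elim
        fix t assume "t \<noteq> x"
        have "\<forall>\<^sub>F n in sequentially. indicator {X n<..} t = (indicator {x<..} t :: real)"
        proof (cases "x < t")
          case True
          then have "\<forall>\<^sub>F n in sequentially. X n < t" using X by (simp add: order_tendstoD)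
          then show ?thesis by eventually_elim (use True in \<open>auto simp: indicator_def\<close>)
        next
          case False
          then have "\<forall>\<^sub>F n in sequentially. t < X n" using X \<open>t \<noteq> x\<close> by (simp add: order_tendstoD)
          then show ?thesis by eventually_elim (use False in \<open>auto simp: indicator_def\<close>)
        qed
        then show "(\<lambda>n. indicator {X n<..} t :: real) \<longlonglongrightarrow> indicator {x<..} t" by (rule tendsto_eventually)
      qed
      have "a / 2 < X n" for n using Xa[rule_format, of n] a by simp
      then show "AE t in \<mu>. norm (indicator {X n<..} t :: real) \<le> indicator {a/2<..} t" for n
        using order_less_trans[of "a/2" "X n"] by (intro AE_I2) (auto simp: indicator_def)
    qed measurable
    then show "(\<lambda>n. tail \<mu> (X n)) \<longlonglongrightarrow> tail \<mu> x" by (simp add: tail_def)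
  qed
  then have "isCont (tail \<mu>) x" if "0 < x" for x
    by (rule continuous_on_interior[of "{x/2..}"]) (use that in auto)
  then show ?thesis by (simp add: continuous_at_imp_continuous_on)
qed

end

section \<open>From the Bernstein function to the Sonine pair\<close>

lemma bernstein_triplet_ge:
  assumes "bernstein_triplet f a b \<mu>" "0 < s"
  shows "a \<le> f s" "b \<le> f s / s"
proof -
  have "0 \<le> (LINT t:{0<..}|\<mu>. 1 - exp (- s * t))"
    unfolding set_lebesgue_integral_def
    by (rule integral_nonneg_AE) (use assms in \<open>auto simp: indicator_def\<close>)
  then have "a + b * s \<le> f s" "0 \<le> a" "0 \<le> b" using assms by (auto simp: bernstein_triplet_def)
  moreover have "0 \<le> b * s" using \<open>0 \<le> b\<close> assms(2) by simp
  ultimately have "a \<le> f s" "b * s \<le> f s" by linarith+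
  then show "a \<le> f s" "b \<le> f s / s" using assms(2) by (auto simp: field_simps)
qed

text \<open>\<open>f s \<ge> a\<close> and \<open>f s / s \<ge> b\<close>, so the two limits force
  \<open>a = b = 0\<close>. Applied to \<open>f\<close> and to its conjugate, whose two limits are
  reciprocals of the infinite limits in \<open>A1\<close>.\<close>

lemma bernstein_triplet_pure_jump:
  assumes f: "bernstein_triplet f a b \<mu>"
    and f0: "(f \<longlongrightarrow> 0) (at_right 0)" and f1: "((\<lambda>x. f x / x) \<longlongrightarrow> 0) at_top" and s: "0 < s"
  shows "(LINT t:{0<..}|\<mu>. 1 - exp (- s * t)) = f s"
proof -
  have "a \<le> 0"
    by (rule tendsto_lowerbound[OF f0])
      (auto simp: eventually_at_right_field intro!: exI[of _ 1] bernstein_triplet_ge[OF f])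
  moreover have "b \<le> 0"
    by (rule tendsto_lowerbound[OF f1])
      (auto simp: eventually_at_top_dense intro!: exI[of _ 0] bernstein_triplet_ge[OF f])
  moreover have "0 \<le> a" "0 \<le> b" using f by (auto simp: bernstein_triplet_def)
  ultimately have "a = 0" "b = 0" by auto
  then show ?thesis using f s by (auto simp: bernstein_triplet_def)
qed

theorem theorem4p1:
  fixes f mubar k :: "real \<Rightarrow> real" and \<mu> \<mu>s :: "real measure"
    and a b as bs T lam \<phi>0 :: real
  assumes A1: "(f \<longlongrightarrow> 0) (at_right 0)"
              "filterlim f at_top at_top"
              "filterlim (\<lambda>x. f x / x) at_top (at_right 0)"
              "((\<lambda>x. f x / x) \<longlongrightarrow> 0) at_top"
    and A2: "complete_bernstein_triplet f a b \<mu>"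
    and conj: "bernstein_triplet (conjugate f) as bs \<mu>s"
    and mubar: "mubar = tail \<mu>"
    and k: "k = tail \<mu>s"
    and limsup: "Limsup (at_right 0) (\<lambda>x. ereal (mubar x * (LINT s:{0<..<x}|lborel. k s))) < 1"
    and T: "T > 0"
    and lam: "lam \<noteq> 0"
  shows "\<exists>\<phi>. censored_ivp_solution mubar T lam \<phi>0 \<phi> \<and>
           (\<forall>\<psi>. censored_ivp_solution mubar T lam \<phi>0 \<psi> \<longrightarrow> (\<forall>x\<in>{0..T}. \<psi> x = \<phi> x)) \<and>
           (\<forall>x\<in>{0..T}.
              summable (\<lambda>i. ((\<lambda>g y. lam * I_Ce mubar k g y) ^^ i) (\<lambda>_. 1) x) \<and>
              \<phi> x = \<phi>0 * (\<Sum>i. ((\<lambda>g y. lam * I_Ce mubar k g y) ^^ i) (\<lambda>_. 1) x))"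
proof -
  have trip: "bernstein_triplet f a b \<mu>" using A2 by (simp add: complete_bernstein_triplet_def)
  then have levy: "levy_measure \<mu>" "levy_measure \<mu>s" using conj by (auto simp: bernstein_triplet_def)
  \<comment> \<open>Complete monotonicity makes the density continuous, hence measurable, and a
    measure with a density has no atoms.\<close>
  have no_atom: "emeasure \<mu> {x} = 0" for x
  proof -
    obtain d where d: "completely_monotone d" "\<mu> = density lborel (\<lambda>t. ennreal (indicator {0<..} t * d t))"
      using A2 by (auto simp: complete_bernstein_triplet_def)
    have "continuous_on {0<..} d"
    proof (rule continuous_at_imp_continuous_on, rule ballI)
      fix x :: real assume "x \<in> {0<..}"
      then have "(deriv ^^ 0) d field_differentiable (at x)"
        using d(1) unfolding completely_monotone_def by blast
      then show "isCont d x" by (simp add: field_differentiable_imp_continuous_at)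
    qed
    then have "(\<lambda>t. indicator {0<..} t * d t) \<in> borel_measurable borel"
      using borel_measurable_continuous_on_indicator[of "{0<..}" d] by simp
    then have "emeasure \<mu> {x} = (\<integral>\<^sup>+t. ennreal (indicator {0<..} t * d t) * indicator {x} t \<partial>lborel)"
      unfolding d(2) by (intro emeasure_density) auto
    also have "\<dots> = (\<integral>\<^sup>+t. 0 \<partial>(lborel :: real measure))"
      using AE_lborel_singleton[of x] by (intro nn_integral_cong_AE) (auto elim!: eventually_mono)
    finally show ?thesis by simp
  qed
  have f_jump: "(LINT t:{0<..}|\<mu>. 1 - exp (- s * t)) = f s" if "0 < s" for s
    by (rule bernstein_triplet_pure_jump[OF trip A1(1,4) that])
  have conj_0: "(conjugate f \<longlongrightarrow> 0) (at_right 0)"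
    using tendsto_inverse_0_at_top[OF A1(3)] by (simp add: conjugate_def[abs_def])
  have "((\<lambda>x. inverse (f x)) \<longlongrightarrow> 0) at_top" by (rule tendsto_inverse_0_at_top[OF A1(2)])
  moreover have "\<forall>\<^sub>F x in at_top. inverse (f x) = conjugate f x / x"
    using eventually_gt_at_top[of 0] by eventually_elim (simp add: conjugate_def inverse_eq_divide)
  ultimately have conj_1: "((\<lambda>x. conjugate f x / x) \<longlongrightarrow> 0) at_top"
    by (rule Lim_transform_eventually)
  have conj_jump: "(LINT t:{0<..}|\<mu>s. 1 - exp (- s * t)) = s / f s" if "0 < s" for s
    using bernstein_triplet_pure_jump[OF conj conj_0 conj_1 that] by (simp add: conjugate_def)
  \<comment> \<open>Beyond \<open>s1\<close> the value \<open>f s\<close> is at least 1, so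
    \<open>f s / s\<close> and \<open>1 / f s\<close> are genuine quotients with product
    \<open>1 / s\<close>. Large arguments are enough for \<open>sonine_if_laplace\<close>; the 1 in
    \<open>s0\<close> makes it positive.\<close>
  obtain s1 where s1: "\<And>s. s1 \<le> s \<Longrightarrow> 1 \<le> f s"
    using A1(2) by (auto simp: filterlim_at_top eventually_at_top_linorder)
  define s0 where "s0 = max 1 s1"
  have lap: "(\<integral>\<^sup>+x. ennreal (indicator {0<..} x * (exp (- (s * x)) * mubar x)) \<partial>lborel) *
      (\<integral>\<^sup>+x. ennreal (indicator {0<..} x * (exp (- (s * x)) * k x)) \<partial>lborel) = ennreal (1 / s)"
    if "s0 \<le> s" for s
  proof -
    have s: "0 < s" "1 \<le> f s" using that s1[of s] by (auto simp: s0_def)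
    then have "ennreal (f s / s) * ennreal (s / f s / s) = ennreal (1 / s)"
      by (simp add: ennreal_mult[symmetric])
    then show ?thesis
      unfolding mubar k laplace_tail[OF levy(1) s(1)] laplace_tail[OF levy(2) s(1)] f_jump[OF s(1)] conj_jump[OF s(1)] .
  qed
  note facts = tail_measurable[OF levy(1), folded mubar] tail_measurable[OF levy(2), folded k]
    tail_nonneg[OF levy(1), folded mubar] tail_nonneg[OF levy(2), folded k]
    tail_antimono[OF levy(1), folded mubar] tail_antimono[OF levy(2), folded k]
    tail_integrable[OF levy(1), folded mubar] tail_integrable[OF levy(2), folded k]
    tail_continuous[OF levy(1) no_atom, folded mubar]
  interpret sonine_pair mubar k
  proof
    show "\<exists>x>0. mubar x < e" if "0 < e" for e
      using tail_small[OF levy(1) that] by (simp add: mubar)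
    show "conv mubar k x = 1" if "0 < x" for x
      by (rule sonine_if_laplace[where r=s0]) (use lap that in \<open>auto intro: facts simp: s0_def\<close>)
  qed (auto intro: facts)
  have "Limsup (at_right 0) (\<lambda>x. ereal (mubar x * kint x)) < 1"
    using limsup by (simp add: kint_def)
  from m_kint_bounded_away[OF this, of T] obtain \<rho>
    where \<rho>: "0 \<le> \<rho>" "\<rho> < 1" "\<forall>x. 0 < x \<longrightarrow> x \<le> T \<longrightarrow> mubar x * kint x \<le> \<rho>"
    by (elim exE conjE)
  interpret C: censored_sonine_pair mubar k T \<rho>
    by unfold_locales (simp_all add: T \<rho>)
  show ?thesis
  proof (intro exI[of _ "\<lambda>x. \<phi>0 * C.solution lam x"] conjI allI impI ballI)
    show "censored_ivp_solution mubar T lam \<phi>0 (\<lambda>x. \<phi>0 * C.solution lam x)"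
      by (rule C.censored_ivp_unique_solution(1))
    show "\<psi> x = \<phi>0 * C.solution lam x"
      if "censored_ivp_solution mubar T lam \<phi>0 \<psi>" "x \<in> {0..T}" for \<psi> x
      using that by (rule C.censored_ivp_unique_solution(2))
    show "summable (\<lambda>i. ((\<lambda>g y. lam * I_Ce mubar k g y) ^^ i) (\<lambda>_. 1) x)" if "x \<in> {0..T}" for x
      using that by (rule C.solution_summable)
  qed (simp add: C.solution_def)
qed

end
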